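(* Let $G=(V,E)$ be a graph on $n$ vertices that is not isomorphic to the 4-cycle $C_4$. If $\deg(u)+\deg(v)\geq n$ for all pairs of distinct non-adjacent vertices $u,v$ of $G$, then $G$ is rigid in $\mathbb{R}^2$.
   Context: All graphs are finite and simple. A graph is rigid in $\mathbb{R}^d$ if some (equivalently every) generic $d$-dimensional bar-and-joint framework of it (vertex positions with coordinates algebraically independent over $\mathbb{Q}$) is rigid, i.e. admits no continuous edge-length-preserving motion changing some pairwise distance. *)

theory Defs
  imports "HOL-Analysis.Analysis"
begin

definition simple_graph :: "'a set \<Rightarrow> 'a set set \<Rightarrow> bool" where
  "simple_graph V E \<longleftrightarrow> finite V \<and>
     (\<forall>e\<in>E. \<exists>u v. e = {u, v} \<and> u \<in> V \<and> v \<in> V \<and> u \<noteq> v)"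

definition degree :: "'a set \<Rightarrow> 'a set set \<Rightarrow> 'a \<Rightarrow> nat" where
  "degree V E v = card {u \<in> V. {u, v} \<in> E}"

definition graph_iso :: "'a set \<Rightarrow> 'a set set \<Rightarrow> 'b set \<Rightarrow> 'b set set \<Rightarrow> bool" where
  "graph_iso V E W F \<longleftrightarrow> (\<exists>f. bij_betw f V W \<and>
     (\<forall>u\<in>V. \<forall>v\<in>V. {u, v} \<in> E \<longleftrightarrow> {f u, f v} \<in> F))"

definition C4_vertices :: "nat set" where
  "C4_vertices = {0, 1, 2, 3}"

definition C4_edges :: "nat set set" where
  "C4_edges = {{0, 1}, {1, 2}, {2, 3}, {3, 0}}"

text \<open>Algebraic independence over the rationals of a finite family y indexed by I:
  no nonzero polynomial with rational coefficients in the variables indexed by I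
  vanishes at y. A polynomial is given by a finitely supported coefficient
  function c on monomials (exponent vectors m supported in I).\<close>

definition alg_indep_rat :: "'i set \<Rightarrow> ('i \<Rightarrow> real) \<Rightarrow> bool" where
  "alg_indep_rat I y \<longleftrightarrow>
     (\<forall>c :: ('i \<Rightarrow> nat) \<Rightarrow> rat.
        finite {m. c m \<noteq> 0} \<and>
        (\<forall>m. c m \<noteq> 0 \<longrightarrow> (\<forall>i. i \<notin> I \<longrightarrow> m i = 0)) \<and>
        (\<Sum>m\<in>{m. c m \<noteq> 0}. of_rat (c m) * (\<Prod>i\<in>I. y i ^ m i)) = 0
        \<longrightarrow> (\<forall>m. c m = 0))"

definition generic_framework :: "'a set \<Rightarrow> ('a \<Rightarrow> real^2) \<Rightarrow> bool" where
  "generic_framework V p \<longleftrightarrow>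
     alg_indep_rat (V \<times> (UNIV :: 2 set)) (\<lambda>(v, i). p v $ i)"

definition rigid_framework :: "'a set \<Rightarrow> 'a set set \<Rightarrow> ('a \<Rightarrow> real^2) \<Rightarrow> bool" where
  "rigid_framework V E p \<longleftrightarrow>
     (\<forall>x :: real \<Rightarrow> 'a \<Rightarrow> real^2.
        (\<forall>v\<in>V. continuous_on {0..1} (\<lambda>t. x t v)) \<and>
        (\<forall>v\<in>V. x 0 v = p v) \<and>
        (\<forall>t\<in>{0..1}. \<forall>u\<in>V. \<forall>v\<in>V. {u, v} \<in> E \<longrightarrow>
            dist (x t u) (x t v) = dist (p u) (p v))
        \<longrightarrow> (\<forall>t\<in>{0..1}. \<forall>u\<in>V. \<forall>v\<in>V. dist (x t u) (x t v) = dist (p u) (p v)))"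

definition rigid_in_R2 :: "'a set \<Rightarrow> 'a set set \<Rightarrow> bool" where
  "rigid_in_R2 V E \<longleftrightarrow> (\<exists>p. generic_framework V p \<and> rigid_framework V E p)"

end

(* Being infinitesimally rigid is stable under small perturbations, and the algebraically independent
   families are dense, so it suffices to find one infinitesimally rigid realization of the graph; moreover
   infinitesimal rigidity implies rigidity. Such realizations survive adding a vertex of degree two
   and joining two parts by three disjoint edges, and $K_{3,3}$ has one. A largest realizable
   vertex set of a graph satisfying the degree condition is then shown to contain all vertices. *)

theory Submission
  imports Defs
begin

section \<open>Infinitesimal rigidity\<close>

text \<open>Since \<open>realizable\<close> asks only for some infinitesimally rigid placement, each
  construction may choose convenient coordinates, and genericity is recovered only at the very end.
  The constructions follow the count of degrees of freedom in the plane: a point has two, hence two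
  edges for a new vertex, and two rigid bodies have three relative ones, hence three joining edges.
  The first fact leaves every vertex outside a largest realizable set with at most one neighbour in
  it, which pushes nearly all of the degree condition into the complement. The obstacle is the
  4-cycle, which satisfies that condition: the induction has to carry it as an alternative, and it
  is excluded for the complement because the inequality obtained there is strict.\<close>

definition inf_motion ::
    "'a set \<Rightarrow> 'a set set \<Rightarrow> ('a \<Rightarrow> real) \<Rightarrow> ('a \<Rightarrow> real) \<Rightarrow> ('a \<Rightarrow> real) \<Rightarrow> ('a \<Rightarrow> real) \<Rightarrow> bool" where
  "inf_motion V E X Y f g \<longleftrightarrow> (\<forall>u\<in>V. \<forall>v\<in>V. {u, v} \<in> E \<longrightarrow>
     (X u - X v) * (f u - f v) + (Y u - Y v) * (g u - g v) = 0)"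

text \<open>These are the velocity fields of plane isometries: translation by (s, t) and rotation
  with angular speed w.\<close>

definition trivial_motion ::
    "'a set \<Rightarrow> ('a \<Rightarrow> real) \<Rightarrow> ('a \<Rightarrow> real) \<Rightarrow> ('a \<Rightarrow> real) \<Rightarrow> ('a \<Rightarrow> real) \<Rightarrow> bool" where
  "trivial_motion V X Y f g \<longleftrightarrow>
     (\<exists>s t w. \<forall>v\<in>V. f v = s - w * Y v \<and> g v = t + w * X v)"

text \<open>Only edges with both ends in V count, so one fixed E serves for all vertex subsets and
  each subset stands for its induced subgraph.\<close>

definition inf_rigid :: "'a set \<Rightarrow> 'a set set \<Rightarrow> ('a \<Rightarrow> real) \<Rightarrow> ('a \<Rightarrow> real) \<Rightarrow> bool" where
  "inf_rigid V E X Y \<longleftrightarrow> (\<forall>f g. inf_motion V E X Y f g \<longrightarrow> trivial_motion V X Y f g)"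

definition realizable :: "'a set \<Rightarrow> 'a set set \<Rightarrow> bool" where
  "realizable V E \<longleftrightarrow> (\<exists>X Y. inf_rigid V E X Y)"

lemma inf_rigidD:
  assumes "inf_rigid V E X Y" and "inf_motion V E X Y f g"
  shows "\<exists>s t w. \<forall>v\<in>V. f v = s - w * Y v \<and> g v = t + w * X v"
  using assms unfolding inf_rigid_def trivial_motion_def by blast

text \<open>Supplies the base edge used for pinning. Without an edge of nonzero length every
  velocity field would be a motion; triviality of the dilation field (X, Y) puts u and v at the same
  height, and then the field moving only u horizontally is not trivial.\<close>

lemma inf_rigid_edge:
  assumes r: "inf_rigid V E X Y" and uv: "u \<in> V" "v \<in> V" "u \<noteq> v"
  obtains a b where "a \<in> V" "b \<in> V" "{a, b} \<in> E" "X a \<noteq> X b \<or> Y a \<noteq> Y b"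
proof (rule ccontr)
  assume "\<not> thesis"
  then have all: "inf_motion V E X Y f g" for f g
    unfolding inf_motion_def using that by fastforce
  obtain s t w where XY: "\<And>v. v \<in> V \<Longrightarrow> X v = s - w * Y v" "\<And>v. v \<in> V \<Longrightarrow> Y v = t + w * X v"
    using inf_rigidD[OF r all[of X Y]] by blast
  have dY: "Y u - Y v = w * (X u - X v)"
    by (subst XY(2)[OF uv(1)], subst XY(2)[OF uv(2)]) (simp add: algebra_simps)
  have dX: "X u - X v = - (w * (Y u - Y v))"
    by (subst XY(1)[OF uv(1)], subst XY(1)[OF uv(2)]) (simp add: algebra_simps)
  have "(Y u - Y v) * (1 + w * w) = 0"
    using dY unfolding dX by (simp add: algebra_simps)
  moreover have "1 + w * w > 0"
    by (simp add: add_pos_nonneg)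
  ultimately have Yuv: "Y u = Y v" by simp
  define f :: "'a \<Rightarrow> real" where "f = (\<lambda>x. if x = u then 1 else 0)"
  obtain s t w where "\<And>v. v \<in> V \<Longrightarrow> f v = s - w * Y v"
    using inf_rigidD[OF r all[of f "\<lambda>_. 0"]] by blast
  from this[OF uv(1)] this[OF uv(2)] Yuv have "f u = f v" by simp
  then show False using uv(3) by (simp add: f_def)
qed

subsection \<open>Stability under perturbation\<close>

text \<open>Vectors are bare functions on an index type that may be infinite; finite families of
  functionals replace a finite-dimensional space.\<close>

definition lin_functional :: "(('i \<Rightarrow> real) \<Rightarrow> real) \<Rightarrow> bool" where
  "lin_functional \<phi> \<longleftrightarrow> (\<forall>a b x y. \<phi> (\<lambda>i. a * x i + b * y i) = a * \<phi> x + b * \<phi> y)"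

lemma lin_functional_diff:
  assumes "lin_functional \<phi>"
  shows "\<phi> (\<lambda>i. x i - b * y i) = \<phi> x - b * \<phi> y"
proof -
  have "\<phi> (\<lambda>i. 1 * x i + (- b) * y i) = 1 * \<phi> x + (- b) * \<phi> y"
    using assms unfolding lin_functional_def by blast
  then show ?thesis by simp
qed

text \<open>A functional vanishing on the common kernel of finitely many others is a combination of
  them, and C bounds the coefficients. The induction either drops a redundant functional or
  subtracts a multiple of it from \<psi>.\<close>

lemma lin_functional_bound:
  assumes "finite F" "\<forall>\<phi>\<in>F. lin_functional \<phi>" "lin_functional \<psi>"
    and "\<And>x. (\<forall>\<phi>\<in>F. \<phi> x = 0) \<Longrightarrow> \<psi> x = 0"
  shows "\<exists>C. \<forall>x \<delta>. (\<forall>\<phi>\<in>F. \<bar>\<phi> x\<bar> \<le> \<delta>) \<and> 0 \<le> \<delta> \<longrightarrow> \<bar>\<psi> x\<bar> \<le> C * \<delta>"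
  using assms
proof (induction F arbitrary: \<psi> rule: finite_induct)
  case empty
  then show ?case by (intro exI[of _ 0]) auto
next
  case (insert \<phi>0 F)
  show ?case
  proof (cases "\<forall>x. (\<forall>\<phi>\<in>F. \<phi> x = 0) \<longrightarrow> \<phi>0 x = 0")
    case True
    then have "\<exists>C. \<forall>x \<delta>. (\<forall>\<phi>\<in>F. \<bar>\<phi> x\<bar> \<le> \<delta>) \<and> 0 \<le> \<delta> \<longrightarrow> \<bar>\<psi> x\<bar> \<le> C * \<delta>"
      using insert.prems by (intro insert.IH) auto
    then show ?thesis by auto
  next
    case False
    then obtain z where z: "\<forall>\<phi>\<in>F. \<phi> z = 0" "\<phi>0 z \<noteq> 0" by blast
    \<comment> \<open>This multiple makes \<psi>' vanish at z. Any x in the kernel of F can be moved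
      along z into the kernel of \<phi>0 as well, so \<psi>' vanishes on the kernel of F
      alone.\<close>
    define c where "c = \<psi> z / \<phi>0 z"
    define \<psi>' where "\<psi>' = (\<lambda>x. \<psi> x - c * \<phi>0 x)"
    have lin': "lin_functional \<psi>'"
      using insert.prems unfolding \<psi>'_def lin_functional_def by (simp add: algebra_simps)
    have "\<psi>' x = 0" if x: "\<forall>\<phi>\<in>F. \<phi> x = 0" for x
    proof -
      let ?y = "\<lambda>i. x i - (\<phi>0 x / \<phi>0 z) * z i"
      have "\<phi> ?y = 0" if "\<phi> \<in> insert \<phi>0 F" for \<phi>
      proof -
        have "\<phi> ?y = \<phi> x - (\<phi>0 x / \<phi>0 z) * \<phi> z"
          using insert.prems(1) that by (intro lin_functional_diff) blast
        then show ?thesis using that x z by auto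
      qed
      then have "\<psi> ?y = 0" using insert.prems(3) by blast
      moreover have "\<psi> ?y = \<psi> x - (\<phi>0 x / \<phi>0 z) * \<psi> z"
        using insert.prems(2) by (rule lin_functional_diff)
      ultimately show ?thesis unfolding \<psi>'_def c_def by (simp add: mult.commute)
    qed
    then have "\<exists>C. \<forall>x \<delta>. (\<forall>\<phi>\<in>F. \<bar>\<phi> x\<bar> \<le> \<delta>) \<and> 0 \<le> \<delta> \<longrightarrow> \<bar>\<psi>' x\<bar> \<le> C * \<delta>"
      using insert.IH[OF _ lin'] insert.prems(1) by auto
    then obtain C where C: "\<And>x \<delta>. (\<forall>\<phi>\<in>F. \<bar>\<phi> x\<bar> \<le> \<delta>) \<Longrightarrow> 0 \<le> \<delta> \<Longrightarrow> \<bar>\<psi>' x\<bar> \<le> C * \<delta>"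
      by blast
    have "\<bar>\<psi> x\<bar> \<le> (C + \<bar>c\<bar>) * \<delta>" if "\<forall>\<phi>\<in>insert \<phi>0 F. \<bar>\<phi> x\<bar> \<le> \<delta>" "0 \<le> \<delta>" for x \<delta>
    proof -
      have "\<bar>\<psi> x\<bar> \<le> \<bar>\<psi>' x\<bar> + \<bar>c\<bar> * \<bar>\<phi>0 x\<bar>"
        unfolding \<psi>'_def abs_mult[symmetric] by linarith
      also have "\<bar>\<psi>' x\<bar> \<le> C * \<delta>" using C that by blast
      also have "\<bar>c\<bar> * \<bar>\<phi>0 x\<bar> \<le> \<bar>c\<bar> * \<delta>" using that by (intro mult_left_mono) auto
      finally show ?thesis by (simp add: algebra_simps)
    qed
    then show ?thesis by blast
  qed
qed

lemma inf_rigid_subsingleton: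
  assumes "\<forall>u\<in>V. \<forall>v\<in>V. u = v"
  shows "inf_rigid V E X Y"
proof (cases "V = {}")
  case True
  then show ?thesis unfolding inf_rigid_def trivial_motion_def by blast
next
  case False
  then obtain v where "V = {v}" using assms by blast
  then show ?thesis unfolding inf_rigid_def trivial_motion_def
    by (metis diff_zero add.right_neutral mult_zero_left singletonD)
qed

text \<open>The motions of \<open>(X, Y)\<close> that fix \<open>a\<close> and move \<open>b\<close> only along the line \<open>ab\<close> vanish, so
  their coordinates are bounded by the values of the edge and pin functionals at \<open>(X, Y)\<close>. A pinned
  motion of a nearby framework makes these values small compared to itself.\<close>

lemma inf_rigid_stable:
  assumes fin: "finite V" and r: "inf_rigid V E X Y"
  shows "\<exists>\<epsilon>>0. \<forall>X' Y'. (\<forall>v\<in>V. \<bar>X' v - X v\<bar> < \<epsilon> \<and> \<bar>Y' v - Y v\<bar> < \<epsilon>) \<longrightarrow> inf_rigid V E X' Y'"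
proof (cases "\<forall>u\<in>V. \<forall>v\<in>V. u = v")
  case True
  then show ?thesis using inf_rigid_subsingleton[OF True] by (intro exI[of _ 1]) simp
next
  case False
  then obtain u v where "u \<in> V" "v \<in> V" "u \<noteq> v" by blast
  then obtain a b where ab: "a \<in> V" "b \<in> V" "X a \<noteq> X b \<or> Y a \<noteq> Y b"
    using inf_rigid_edge[OF r] by metis
  define p where "p = X b - X a"
  define q where "q = Y b - Y a"
  define D where "D = p * p + q * q"
  have D: "D > 0"
    using ab(3) unfolding D_def p_def q_def
    by (metis eq_iff_diff_eq_0 not_sum_squares_lt_zero sum_squares_eq_zero_iff linorder_neqE_linordered_idom)
  define ed where "ed = (\<lambda>(u, v) (m :: 'a \<times> bool \<Rightarrow> real).
    (X u - X v) * (m (u, True) - m (v, True)) + (Y u - Y v) * (m (u, False) - m (v, False)))"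
  \<comment> \<open>The component of the velocity of b perpendicular to ab, up to scale. Together
    with both velocity components of a it detects all three trivial motions.\<close>
  define pin where "pin = (\<lambda>m :: 'a \<times> bool \<Rightarrow> real. - q * m (b, True) + p * m (b, False))"
  define F where "F = ed ` {(u, v). u \<in> V \<and> v \<in> V \<and> {u, v} \<in> E} \<union>
    {\<lambda>m. m (a, True), \<lambda>m. m (a, False), pin}"
  have finF: "finite F"
  proof -
    have "finite {(u, v). u \<in> V \<and> v \<in> V \<and> {u, v} \<in> E}"
      by (rule finite_subset[of _ "V \<times> V"]) (use fin in auto)
    then show ?thesis unfolding F_def by blast
  qed
  have lin: "\<forall>\<phi>\<in>F. lin_functional \<phi>"
    unfolding F_def lin_functional_def ed_def pin_def by (auto simp: algebra_simps)
  have ker: "m (v, k) = 0" if m0: "\<forall>\<phi>\<in>F. \<phi> m = 0" and v: "v \<in> V" for m v k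
  proof -
    have m': "inf_motion V E X Y (\<lambda>v. m (v, True)) (\<lambda>v. m (v, False))"
      unfolding inf_motion_def
    proof (intro ballI impI)
      fix u v assume "u \<in> V" "v \<in> V" "{u, v} \<in> E"
      then have "ed (u, v) \<in> F" unfolding F_def by blast
      then show "(X u - X v) * (m (u, True) - m (v, True)) + (Y u - Y v) * (m (u, False) - m (v, False)) = 0"
        using m0 unfolding ed_def by fastforce
    qed
    obtain s t w where st: "\<And>v. v \<in> V \<Longrightarrow> m (v, True) = s - w * Y v"
        "\<And>v. v \<in> V \<Longrightarrow> m (v, False) = t + w * X v"
      using inf_rigidD[OF r m'] by blast
    have a0: "m (a, True) = 0" "m (a, False) = 0" and b0: "pin m = 0"
      using m0 unfolding F_def by auto
    then have s: "s = w * Y a" and t: "t = - (w * X a)"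
      using st(1)[OF ab(1)] st(2)[OF ab(1)] by auto
    have "w * D = 0"
      using b0 st(1)[OF ab(2)] st(2)[OF ab(2)] s t unfolding pin_def D_def p_def q_def
      by (simp add: algebra_simps)
    then have "w = 0" using D by simp
    then show ?thesis using st[OF v] s t by (cases k) auto
  qed
  have "\<exists>C. \<forall>m \<delta>. (\<forall>\<phi>\<in>F. \<bar>\<phi> m\<bar> \<le> \<delta>) \<and> 0 \<le> \<delta> \<longrightarrow> \<bar>m i\<bar> \<le> C * \<delta>" if "i \<in> V \<times> UNIV" for i
    using that ker
    by (intro lin_functional_bound[OF finF lin]) (auto simp: lin_functional_def)
  then obtain C where C: "\<And>i m \<delta>. i \<in> V \<times> UNIV \<Longrightarrow> (\<forall>\<phi>\<in>F. \<bar>\<phi> m\<bar> \<le> \<delta>) \<Longrightarrow> 0 \<le> \<delta> \<Longrightarrow> \<bar>m i\<bar> \<le> C i * \<delta>"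
    by metis
  define K where "K = (\<Sum>i\<in>V \<times> (UNIV :: bool set). \<bar>C i\<bar>)"
  have K0: "K \<ge> 0" unfolding K_def by (simp add: sum_nonneg)
  have K: "\<bar>m i\<bar> \<le> K * \<delta>" if "i \<in> V \<times> UNIV" "\<forall>\<phi>\<in>F. \<bar>\<phi> m\<bar> \<le> \<delta>" "0 \<le> \<delta>" for i m \<delta>
  proof -
    have "C i \<le> \<bar>C i\<bar>" by simp
    also have "\<dots> \<le> K" unfolding K_def
      by (rule member_le_sum) (use that(1) fin in auto)
    finally have "C i * \<delta> \<le> K * \<delta>" using that(3) by (rule mult_right_mono)
    then show ?thesis using C[OF that] by linarith
  qed
  \<comment> \<open>The first bound keeps D' below positive. The second gives 8 \<epsilon> K < 1, so
    that the final estimate M \<le> 8 \<epsilon> K M forces M = 0. The \<open>+ 1\<close> terms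
    avoid division by zero.\<close>
  define \<epsilon> where "\<epsilon> = min (D / (4 * (\<bar>p\<bar> + \<bar>q\<bar> + 1))) (1 / (8 * (K + 1)))"
  have e0: "\<epsilon> > 0"
    using D K0 unfolding \<epsilon>_def by (auto intro!: divide_pos_pos)
  have e1: "\<epsilon> * (\<bar>p\<bar> + \<bar>q\<bar> + 1) \<le> D / 4"
  proof -
    have "\<epsilon> \<le> D / (4 * (\<bar>p\<bar> + \<bar>q\<bar> + 1))" unfolding \<epsilon>_def by simp
    then show ?thesis by (simp add: field_simps)
  qed
  have e2: "8 * \<epsilon> * (K + 1) \<le> 1"
  proof -
    have "\<epsilon> \<le> 1 / (8 * (K + 1))" unfolding \<epsilon>_def by simp
    then show ?thesis using K0 by (simp add: field_simps)
  qed
  have "inf_rigid V E X' Y'" if close: "\<forall>v\<in>V. \<bar>X' v - X v\<bar> < \<epsilon> \<and> \<bar>Y' v - Y v\<bar> < \<epsilon>" for X' Y'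
    unfolding inf_rigid_def
  proof (intro allI impI)
    fix f g assume fg: "inf_motion V E X' Y' f g"
    define p' where "p' = X' b - X' a"
    define q' where "q' = Y' b - Y' a"
    define D' where "D' = p * p' + q * q'"
    have "\<bar>p' - p\<bar> \<le> 2 * \<epsilon>" "\<bar>q' - q\<bar> \<le> 2 * \<epsilon>"
      using close[rule_format, OF ab(1)] close[rule_format, OF ab(2)]
      unfolding p_def q_def p'_def q'_def by linarith+
    then have "\<bar>p * (p' - p)\<bar> \<le> \<bar>p\<bar> * (2 * \<epsilon>)" "\<bar>q * (q' - q)\<bar> \<le> \<bar>q\<bar> * (2 * \<epsilon>)"
      by (auto simp: abs_mult intro: mult_left_mono)
    moreover have "D' = D + p * (p' - p) + q * (q' - q)"
      unfolding D_def D'_def by (simp add: algebra_simps)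
    ultimately have "D' \<ge> D - 2 * (\<epsilon> * (\<bar>p\<bar> + \<bar>q\<bar> + 1))"
      using e0 by (simp add: algebra_simps)
    then have D': "D' > 0" using e1 D by linarith
    \<comment> \<open>D' is the value of \<open>pin\<close> on the unit rotation about a in the new
      framework. Removing the velocity of a and a rotation of this speed therefore leaves a motion
      \<open>m\<close> with \<open>pin m = 0\<close>.\<close>
    define w where "w = (- q * (f b - f a) + p * (g b - g a)) / D'"
    define m where "m = (\<lambda>(v, k). if k then f v - f a + w * (Y' v - Y' a)
                                  else g v - g a - w * (X' v - X' a))"
    have mT: "m (v, True) = f v - f a + w * (Y' v - Y' a)"
      and mF: "m (v, False) = g v - g a - w * (X' v - X' a)" for v
      unfolding m_def by auto
    have aV: "(a, True) \<in> V \<times> UNIV" using ab by simp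
    define M where "M = Max ((\<lambda>i. \<bar>m i\<bar>) ` (V \<times> UNIV))"
    have finI: "finite ((\<lambda>i. \<bar>m i\<bar>) ` (V \<times> UNIV))" using fin by simp
    have M: "\<bar>m i\<bar> \<le> M" if "i \<in> V \<times> UNIV" for i
      unfolding M_def using that by (intro Max_ge finI) blast
    have M0: "0 \<le> M" using M[OF aV] by linarith
    \<comment> \<open>The edge expression of the new framework vanishes at \<open>m\<close>, so only
      the change of framework contributes: position differences change by at most 2 \<epsilon>,
      velocity differences are at most 2 M, and there are two coordinates.\<close>
    have edge: "\<bar>ed (u, v) m\<bar> \<le> 8 * \<epsilon> * M" if uv: "u \<in> V" "v \<in> V" "{u, v} \<in> E" for u v
    proof -
      have "(X' u - X' v) * (f u - f v) + (Y' u - Y' v) * (g u - g v) = 0"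
        using fg uv unfolding inf_motion_def by blast
      then have "(X' u - X' v) * (m (u, True) - m (v, True)) + (Y' u - Y' v) * (m (u, False) - m (v, False)) = 0"
        unfolding mT mF by (simp add: algebra_simps)
      then have eq: "ed (u, v) m = ((X u - X v) - (X' u - X' v)) * (m (u, True) - m (v, True))
          + ((Y u - Y v) - (Y' u - Y' v)) * (m (u, False) - m (v, False))"
        unfolding ed_def by (simp add: algebra_simps)
      have "\<bar>(X u - X v) - (X' u - X' v)\<bar> \<le> 2 * \<epsilon>" "\<bar>(Y u - Y v) - (Y' u - Y' v)\<bar> \<le> 2 * \<epsilon>"
        using close[rule_format, OF uv(1)] close[rule_format, OF uv(2)] by linarith+
      moreover have "\<bar>m (u, k) - m (v, k)\<bar> \<le> 2 * M" for k
        using M[of "(u, k)"] M[of "(v, k)"] uv by auto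
      moreover have "\<bar>x * y\<bar> \<le> (2 * \<epsilon>) * (2 * M)" if "\<bar>x\<bar> \<le> 2 * \<epsilon>" "\<bar>y\<bar> \<le> 2 * M" for x y
        unfolding abs_mult using that e0 by (intro mult_mono) simp_all
      ultimately have "\<bar>((X u - X v) - (X' u - X' v)) * (m (u, True) - m (v, True))\<bar> \<le> (2 * \<epsilon>) * (2 * M)"
          "\<bar>((Y u - Y v) - (Y' u - Y' v)) * (m (u, False) - m (v, False))\<bar> \<le> (2 * \<epsilon>) * (2 * M)"
        by blast+
      then show ?thesis unfolding eq by linarith
    qed
    have pin0: "pin m = 0"
    proof -
      have "pin m = - q * (f b - f a) + p * (g b - g a) - w * D'"
        unfolding pin_def mT mF D'_def p'_def q'_def by (simp add: algebra_simps)
      then show ?thesis unfolding w_def using D' by simp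
    qed
    have "0 \<le> 8 * \<epsilon> * M" using e0 M0 by simp
    then have "\<forall>\<phi>\<in>F. \<bar>\<phi> m\<bar> \<le> 8 * \<epsilon> * M"
      unfolding F_def using edge pin0 by (auto simp: mT mF)
    then have small: "\<bar>m i\<bar> \<le> K * (8 * \<epsilon> * M)" if "i \<in> V \<times> UNIV" for i
      using K[OF that] \<open>0 \<le> 8 * \<epsilon> * M\<close> by blast
    have "M \<in> (\<lambda>i. \<bar>m i\<bar>) ` (V \<times> UNIV)"
      unfolding M_def using aV by (intro Max_in finI) blast
    then have "M \<le> K * (8 * \<epsilon> * M)" using small by auto
    moreover have "8 * \<epsilon> * (K + 1) * M \<le> 1 * M" using e2 M0 by (rule mult_right_mono)
    ultimately have "8 * \<epsilon> * M \<le> 0" by (simp add: algebra_simps)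
    then have "M = 0" using e0 M0 by (simp add: mult_le_0_iff)
    then have m0: "m (v, k) = 0" if "v \<in> V" for v k
      using M[of "(v, k)"] that by simp
    have "f v = (f a + w * Y' a) - w * Y' v \<and> g v = (g a - w * X' a) + w * X' v" if "v \<in> V" for v
      using m0[OF that, of True] m0[OF that, of False] unfolding mT mF by (simp add: algebra_simps)
    then show "trivial_motion V X' Y' f g" unfolding trivial_motion_def by blast
  qed
  then show ?thesis using e0 by blast
qed

section \<open>Realizable graphs\<close>

lemma inf_motion_mono:
  assumes "inf_motion V E X Y f g" "U \<subseteq> V"
  shows "inf_motion U E X Y f g"
  using assms unfolding inf_motion_def by blast

lemma inf_rigid_cong:
  assumes "\<And>v. v \<in> V \<Longrightarrow> X v = X' v" "\<And>v. v \<in> V \<Longrightarrow> Y v = Y' v"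
  shows "inf_rigid V E X Y \<longleftrightarrow> inf_rigid V E X' Y'"
  unfolding inf_rigid_def inf_motion_def trivial_motion_def using assms by simp

text \<open>The edge condition pairs position and velocity differences, so motions of the image pull
  back along the transposed linear part. Trivial motions correspond, with the rotation speed divided
  by the determinant.\<close>

lemma inf_rigid_affine:
  assumes r: "inf_rigid V E X Y" and det: "\<alpha> * \<delta> - \<beta> * \<gamma> \<noteq> 0"
  shows "inf_rigid V E (\<lambda>v. \<alpha> * X v + \<beta> * Y v + \<sigma>) (\<lambda>v. \<gamma> * X v + \<delta> * Y v + \<tau>)"
    (is "inf_rigid V E ?X ?Y")
  unfolding inf_rigid_def
proof (intro allI impI)
  fix f g assume m: "inf_motion V E ?X ?Y f g"
  define \<Delta> where "\<Delta> = \<alpha> * \<delta> - \<beta> * \<gamma>"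
  have \<Delta>: "\<Delta> \<noteq> 0" using det by (simp add: \<Delta>_def)
  have m': "inf_motion V E X Y (\<lambda>v. \<alpha> * f v + \<gamma> * g v) (\<lambda>v. \<beta> * f v + \<delta> * g v)"
    unfolding inf_motion_def
  proof (intro ballI impI)
    fix u v assume "u \<in> V" "v \<in> V" "{u, v} \<in> E"
    then have "(?X u - ?X v) * (f u - f v) + (?Y u - ?Y v) * (g u - g v) = 0"
      using m unfolding inf_motion_def by blast
    then show "(X u - X v) * (\<alpha> * f u + \<gamma> * g u - (\<alpha> * f v + \<gamma> * g v)) +
         (Y u - Y v) * (\<beta> * f u + \<delta> * g u - (\<beta> * f v + \<delta> * g v)) = 0"
      by (simp add: algebra_simps)
  qed
  obtain s t w where st: "\<And>v. v \<in> V \<Longrightarrow> \<alpha> * f v + \<gamma> * g v = s - w * Y v"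
      "\<And>v. v \<in> V \<Longrightarrow> \<beta> * f v + \<delta> * g v = t + w * X v"
    using inf_rigidD[OF r m'] by blast
  let ?w = "w / \<Delta>"
  have "f v = ((\<delta> * s - \<gamma> * t) / \<Delta> + ?w * \<tau>) - ?w * ?Y v \<and>
        g v = ((\<alpha> * t - \<beta> * s) / \<Delta> - ?w * \<sigma>) + ?w * ?X v" if v: "v \<in> V" for v
  proof -
    have "\<Delta> * f v = \<delta> * (\<alpha> * f v + \<gamma> * g v) - \<gamma> * (\<beta> * f v + \<delta> * g v)"
      "\<Delta> * g v = \<alpha> * (\<beta> * f v + \<delta> * g v) - \<beta> * (\<alpha> * f v + \<gamma> * g v)"
      unfolding \<Delta>_def by (simp_all add: algebra_simps)
    then have "\<Delta> * f v = \<delta> * (s - w * Y v) - \<gamma> * (t + w * X v)"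
      "\<Delta> * g v = \<alpha> * (t + w * X v) - \<beta> * (s - w * Y v)"
      using st[OF v] by simp_all
    then have "f v = (\<delta> * (s - w * Y v) - \<gamma> * (t + w * X v)) / \<Delta>"
      "g v = (\<alpha> * (t + w * X v) - \<beta> * (s - w * Y v)) / \<Delta>"
      using \<Delta> by (simp_all add: eq_divide_eq mult.commute)
    then show ?thesis
      by (simp add: diff_divide_distrib add_divide_distrib algebra_simps)
  qed
  then show "trivial_motion V ?X ?Y f g" unfolding trivial_motion_def by blast
qed

lemma realizable_distinct:
  assumes "finite V" "realizable V E" "a \<in> V" "b \<in> V" "a \<noteq> b"
  obtains X Y where "inf_rigid V E X Y" "X a \<noteq> X b"
proof -
  obtain X Y where r: "inf_rigid V E X Y" using assms unfolding realizable_def by blast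
  then obtain \<epsilon> where \<epsilon>: "\<epsilon> > 0" "\<And>X' Y'. (\<forall>v\<in>V. \<bar>X' v - X v\<bar> < \<epsilon> \<and> \<bar>Y' v - Y v\<bar> < \<epsilon>) \<Longrightarrow> inf_rigid V E X' Y'"
    using inf_rigid_stable[OF assms(1) r] by blast
  show thesis
  proof (cases "X a = X b")
    case True
    have "inf_rigid V E (X(a := X a + \<epsilon> / 2)) Y"
      using \<epsilon>(1) by (intro \<epsilon>(2)) auto
    then show thesis by (rule that) (use True assms \<epsilon>(1) in auto)
  qed (use r that in blast)
qed

text \<open>As X a \<noteq> X b, the line ab is not vertical, so a small vertical shift of c leaves
  it. An affine map then sends the nondegenerate triangle to the standard one.\<close>

lemma realizable_triple:
  assumes "finite V" "realizable V E" "a \<in> V" "b \<in> V" "c \<in> V" "a \<noteq> b" "a \<noteq> c" "b \<noteq> c"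
  obtains X Y where "inf_rigid V E X Y" "X a = 0" "Y a = 0" "X b = 1" "Y b = 0" "X c = 0" "Y c = 1"
proof -
  obtain X Y where r: "inf_rigid V E X Y" and ab: "X a \<noteq> X b"
    using realizable_distinct[OF assms(1-4,6)] by blast
  obtain \<epsilon> where \<epsilon>: "\<epsilon> > 0" "\<And>X' Y'. (\<forall>v\<in>V. \<bar>X' v - X v\<bar> < \<epsilon> \<and> \<bar>Y' v - Y v\<bar> < \<epsilon>) \<Longrightarrow> inf_rigid V E X' Y'"
    using inf_rigid_stable[OF assms(1) r] by blast
  let ?det = "\<lambda>Y. (X b - X a) * (Y c - Y a) - (X c - X a) * (Y b - Y a)"
  have "\<exists>Y'. inf_rigid V E X Y' \<and> ?det Y' \<noteq> 0"
  proof (cases "?det Y = 0")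
    case True
    let ?Y' = "Y(c := Y c + \<epsilon> / 2)"
    have "inf_rigid V E X ?Y'" using \<epsilon>(1) by (intro \<epsilon>(2)) auto
    moreover have "?det ?Y' = ?det Y + (X b - X a) * (\<epsilon> / 2)"
      using assms by (simp add: algebra_simps)
    then have "?det ?Y' \<noteq> 0" unfolding True using ab \<epsilon>(1) by (metis add_0 divide_eq_0_iff eq_iff_diff_eq_0 less_irrefl mult_eq_0_iff zero_neq_numeral)
    ultimately show ?thesis by blast
  qed (use r in blast)
  then obtain Y' where r': "inf_rigid V E X Y'" and det: "?det Y' \<noteq> 0" by blast
  define p1 p2 q1 q2 where pq: "p1 = X b - X a" "p2 = X c - X a" "q1 = Y' b - Y' a" "q2 = Y' c - Y' a"
  define d where "d = p1 * q2 - p2 * q1"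
  have d: "d \<noteq> 0" using det unfolding d_def pq by simp
  let ?X = "\<lambda>v. (q2 / d) * X v + (- p2 / d) * Y' v + (p2 * Y' a - q2 * X a) / d"
  let ?Y = "\<lambda>v. (- q1 / d) * X v + (p1 / d) * Y' v + (q1 * X a - p1 * Y' a) / d"
  have "(q2 / d) * (p1 / d) - (- p2 / d) * (- q1 / d) = d / (d * d)"
    unfolding d_def by (simp add: diff_divide_distrib algebra_simps)
  then have "inf_rigid V E ?X ?Y"
    using d by (intro inf_rigid_affine[OF r']) simp
  moreover have "?X v = (q2 * (X v - X a) - p2 * (Y' v - Y' a)) / d"
    and "?Y v = (p1 * (Y' v - Y' a) - q1 * (X v - X a)) / d" for v
    by (simp_all add: diff_divide_distrib add_divide_distrib algebra_simps)
  ultimately show thesis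
    using d by (intro that[of ?X ?Y]) (simp_all add: pq[symmetric], simp_all add: d_def algebra_simps)
qed

lemma realizable_edge:
  assumes "{a, b} \<in> E" "a \<noteq> b"
  shows "realizable {a, b} E"
proof -
  let ?X = "\<lambda>v. if v = a then 0 else 1 :: real"
  have "inf_rigid {a, b} E ?X (\<lambda>_. 0)"
    unfolding inf_rigid_def
  proof (intro allI impI)
    fix f g assume m: "inf_motion {a, b} E ?X (\<lambda>_. 0) f g"
    then have "f a = f b" using assms unfolding inf_motion_def by force
    then show "trivial_motion {a, b} ?X (\<lambda>_. 0) f g"
      unfolding trivial_motion_def using assms
      by (intro exI[of _ "f a"] exI[of _ "g a"] exI[of _ "g b - g a"]) auto
  qed
  then show ?thesis unfolding realizable_def by blast
qed

text \<open>The new point is put one unit above a. The edge to a fixes its vertical velocity, and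
  the edge to b, not vertical because X a \<noteq> X b, fixes the horizontal one.\<close>

lemma realizable_insert:
  assumes fin: "finite V" and r: "realizable V E" and x: "x \<notin> V"
    and ab: "a \<in> V" "b \<in> V" "a \<noteq> b" "{a, x} \<in> E" "{b, x} \<in> E"
  shows "realizable (insert x V) E"
proof -
  obtain X Y where r: "inf_rigid V E X Y" and ne: "X a \<noteq> X b"
    using realizable_distinct[OF fin r ab(1-3)] by blast
  define X' where "X' = X(x := X a)"
  define Y' where "Y' = Y(x := Y a + 1)"
  have same: "X' v = X v" "Y' v = Y v" if "v \<in> V" for v
    using that x unfolding X'_def Y'_def by auto
  have xx: "X' x = X a" "Y' x = Y a + 1" unfolding X'_def Y'_def by auto
  have "inf_rigid (insert x V) E X' Y'"
    unfolding inf_rigid_def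
  proof (intro allI impI)
    fix f g assume m: "inf_motion (insert x V) E X' Y' f g"
    have r': "inf_rigid V E X' Y'" using r inf_rigid_cong[of V X X' Y Y'] same by auto
    obtain s t w where st: "\<And>v. v \<in> V \<Longrightarrow> f v = s - w * Y' v" "\<And>v. v \<in> V \<Longrightarrow> g v = t + w * X' v"
      using inf_rigidD[OF r' inf_motion_mono[OF m subset_insertI]] by blast
    have "(X' a - X' x) * (f a - f x) + (Y' a - Y' x) * (g a - g x) = 0"
      "(X' b - X' x) * (f b - f x) + (Y' b - Y' x) * (g b - g x) = 0"
      using m ab unfolding inf_motion_def by auto
    then have ga: "g x = g a" and fx: "(X b - X a) * (f b - f x) + (Y b - Y a - 1) * (g b - g x) = 0"
      using ab by (simp_all add: xx same algebra_simps)
    have "(X b - X a) * (f x - s + w * (Y a + 1)) = 0"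
      using fx ab unfolding ga by (simp add: st same algebra_simps)
    then have "f x = s - w * Y' x" using ne unfolding xx by simp
    moreover have "g x = t + w * X' x" using ga ab by (simp add: st xx same)
    ultimately show "trivial_motion (insert x V) X' Y' f g"
      unfolding trivial_motion_def using st by (metis insert_iff)
  qed
  then show ?thesis unfolding realizable_def by blast
qed

lemma realizable_triangle:
  assumes "{a, b} \<in> E" "{b, c} \<in> E" "{a, c} \<in> E" "a \<noteq> b" "b \<noteq> c" "a \<noteq> c"
  shows "realizable {a, b, c} E"
proof -
  have "realizable (insert c {a, b}) E"
    by (rule realizable_insert[of _ _ _ a b]) (use assms realizable_edge[of a b] in auto)
  then show ?thesis by (simp add: insert_commute)
qed

text \<open>By an affine change of coordinates the ends \<open>a\<^sub>i\<close> and the ends \<open>b\<^sub>i\<close> are the same three points,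
  cyclically shifted, so that the three joining edges span the sides of a triangle.\<close>

lemma realizable_join:
  assumes fin: "finite U" "finite W" and disj: "U \<inter> W = {}"
    and r: "realizable U E" "realizable W E"
    and a: "a1 \<in> U" "a2 \<in> U" "a3 \<in> U" "a1 \<noteq> a2" "a1 \<noteq> a3" "a2 \<noteq> a3"
    and b: "b1 \<in> W" "b2 \<in> W" "b3 \<in> W" "b1 \<noteq> b2" "b1 \<noteq> b3" "b2 \<noteq> b3"
    and e: "{a1, b1} \<in> E" "{a2, b2} \<in> E" "{a3, b3} \<in> E"
  shows "realizable (U \<union> W) E"
proof -
  obtain X Y where XY: "inf_rigid U E X Y" "X a1 = 0" "Y a1 = 0" "X a2 = 1" "Y a2 = 0" "X a3 = 0" "Y a3 = 1"
    using realizable_triple[OF fin(1) r(1) a] by blast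
  obtain X' Y' where XY': "inf_rigid W E X' Y'" "X' b3 = 0" "Y' b3 = 0" "X' b1 = 1" "Y' b1 = 0" "X' b2 = 0" "Y' b2 = 1"
    using realizable_triple[OF fin(2) r(2), of b3 b1 b2] b by metis
  define P where "P = (\<lambda>v. if v \<in> U then X v else X' v)"
  define Q where "Q = (\<lambda>v. if v \<in> U then Y v else Y' v)"
  have U: "P v = X v" "Q v = Y v" if "v \<in> U" for v using that by (auto simp: P_def Q_def)
  have W: "P v = X' v" "Q v = Y' v" if "v \<in> W" for v using that disj by (auto simp: P_def Q_def)
  have rU: "inf_rigid U E P Q" using XY(1) inf_rigid_cong[of U X P Y Q] U by simp
  have rW: "inf_rigid W E P Q" using XY'(1) inf_rigid_cong[of W X' P Y' Q] W by simp
  have "inf_rigid (U \<union> W) E P Q"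
    unfolding inf_rigid_def
  proof (intro allI impI)
    fix f g assume m: "inf_motion (U \<union> W) E P Q f g"
    obtain s t w where st: "\<And>v. v \<in> U \<Longrightarrow> f v = s - w * Q v" "\<And>v. v \<in> U \<Longrightarrow> g v = t + w * P v"
      using inf_rigidD[OF rU inf_motion_mono[OF m Un_upper1]] by blast
    obtain s' t' w' where st': "\<And>v. v \<in> W \<Longrightarrow> f v = s' - w' * Q v" "\<And>v. v \<in> W \<Longrightarrow> g v = t' + w' * P v"
      using inf_rigidD[OF rW inf_motion_mono[OF m Un_upper2]] by blast
    have "(P a - P b) * (f a - f b) + (Q a - Q b) * (g a - g b) = 0" if "a \<in> U" "b \<in> W" "{a, b} \<in> E" for a b
      using m that unfolding inf_motion_def by blast
    \<comment> \<open>The first edge is horizontal and gives s = s', the third is vertical and gives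
      t = t', and the diagonal second one then gives w = w'.\<close>
    from this[OF a(1) b(1) e(1)] this[OF a(2) b(2) e(2)] this[OF a(3) b(3) e(3)]
    have "s = s'" "t = t'" "w = w'"
      using a b XY XY' by (auto simp: st st' U W)
    then show "trivial_motion (U \<union> W) P Q f g"
      unfolding trivial_motion_def using st st' by (metis Un_iff)
  qed
  then show ?thesis unfolding realizable_def by blast
qed

text \<open>A realization of $K_{3,3}$ is infinitesimally rigid if and only if its vertices do not lie on a conic.
  No conic passes through \<open>(0,0), (1,0), (0,1), (1,1), (2,0), (0,2)\<close>.\<close>

lemma realizable_K33:
  assumes d: "distinct [a1, a2, a3, b1, b2, b3]"
    and e: "\<And>a b. a \<in> {a1, a2, a3} \<Longrightarrow> b \<in> {b1, b2, b3} \<Longrightarrow> {a, b} \<in> E"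
  shows "realizable {a1, a2, a3, b1, b2, b3} E"
proof -
  let ?V = "{a1, a2, a3, b1, b2, b3}"
  define X :: "'a \<Rightarrow> real" where
    "X = (\<lambda>v. if v = a2 \<or> v = b1 then 1 else if v = b2 then 2 else 0)"
  define Y :: "'a \<Rightarrow> real" where
    "Y = (\<lambda>v. if v = a3 \<or> v = b1 then 1 else if v = b3 then 2 else 0)"
  have X: "X a1 = 0" "X a2 = 1" "X a3 = 0" "X b1 = 1" "X b2 = 2" "X b3 = 0"
    and Y: "Y a1 = 0" "Y a2 = 0" "Y a3 = 1" "Y b1 = 1" "Y b2 = 0" "Y b3 = 2"
    using d unfolding X_def Y_def by auto
  have "inf_rigid ?V E X Y"
    unfolding inf_rigid_def
  proof (intro allI impI)
    fix f g assume m: "inf_motion ?V E X Y f g"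
    have eq: "(X a - X b) * (f a - f b) + (Y a - Y b) * (g a - g b) = 0"
      if "a \<in> {a1, a2, a3}" "b \<in> {b1, b2, b3}" for a b
      using m e[OF that] that unfolding inf_motion_def by blast
    note eqs = eq[of a1 b1] eq[of a1 b2] eq[of a1 b3] eq[of a2 b1] eq[of a2 b2] eq[of a2 b3]
      eq[of a3 b1] eq[of a3 b2] eq[of a3 b3]
    \<comment> \<open>With a1 at (0,0) and a2 at (1,0), this difference is the angular speed of a
      trivial motion.\<close>
    define w where "w = g a2 - g a1"
    have "f a1 + g a1 = f b1 + g b1" "f b2 = f a1" "g b3 = g a1" "g b1 = g a2"
      "f b2 = f a2" "f a2 - 2 * g a2 = f b3 - 2 * g b3" "f b1 = f a3"
      "2 * f a3 - g a3 = 2 * f b2 - g b2" "g b3 = g a3"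
      using eqs by (simp_all add: X Y)
    then have "f a2 = f a1" "f a3 = f a1 - w" "f b1 = f a1 - w" "f b2 = f a1" "f b3 = f a1 - 2 * w"
      "g a2 = g a1 + w" "g a3 = g a1" "g b1 = g a1 + w" "g b2 = g a1 + 2 * w" "g b3 = g a1"
      using w_def by linarith+
    then have "\<forall>v\<in>?V. f v = f a1 - w * Y v \<and> g v = g a1 + w * X v"
      by (simp add: X Y)
    then show "trivial_motion ?V X Y f g" unfolding trivial_motion_def by blast
  qed
  then show ?thesis unfolding realizable_def by blast
qed

section \<open>Density of algebraically independent families\<close>

text \<open>The graph over the support determines the function and is a finite subset of a countable
  set. Serves both for exponent vectors and for coefficient functions.\<close>

lemma countable_finite_support_fun:
  fixes S :: "'b set"
  assumes "countable S"
  shows "countable {c :: 'b \<Rightarrow> 'c :: {zero, countable}. finite {m. c m \<noteq> 0} \<and> {m. c m \<noteq> 0} \<subseteq> S}"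
    (is "countable ?C")
proof -
  define G where "G = (\<lambda>c :: 'b \<Rightarrow> 'c. (\<lambda>m. (m, c m)) ` {m. c m \<noteq> 0})"
  have "countable (S \<times> (UNIV :: 'c set))" using assms by (intro countable_SIGMA countableI_type)
  then have "countable {A. finite A \<and> A \<subseteq> S \<times> (UNIV :: 'c set)}"
    by (rule countable_Collect_finite_subset)
  moreover have "G ` ?C \<subseteq> {A. finite A \<and> A \<subseteq> S \<times> UNIV}"
    unfolding G_def by auto
  ultimately have "countable (G ` ?C)" by (rule countable_subset[rotated])
  moreover have "inj G"
  proof (rule injI, rule ext)
    fix c d m assume "G c = G d"
    then have "(m, x) \<in> G c \<longleftrightarrow> (m, x) \<in> G d" for x by simp
    then show "c m = d m" unfolding G_def by (auto simp: image_iff) metis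
  qed
  ultimately show ?thesis using countable_image_inj_on inj_on_subset by blast
qed

lemma countable_exponents:
  assumes "finite J"
  shows "countable {m :: 'i \<Rightarrow> nat. \<forall>j. j \<notin> J \<longrightarrow> m j = 0}"
proof -
  have "countable {m :: 'i \<Rightarrow> nat. finite {i. m i \<noteq> 0} \<and> {i. m i \<noteq> 0} \<subseteq> J}"
    using assms by (intro countable_finite_support_fun countable_finite)
  moreover have "finite {i. m i \<noteq> 0} \<and> {i. m i \<noteq> 0} \<subseteq> J" if "\<forall>j. j \<notin> J \<longrightarrow> m j = 0" for m :: "'i \<Rightarrow> nat"
  proof -
    have "{i. m i \<noteq> 0} \<subseteq> J" using that by auto
    then show ?thesis using finite_subset assms by blast
  qed
  then have "{m :: 'i \<Rightarrow> nat. \<forall>j. j \<notin> J \<longrightarrow> m j = 0} \<subseteq> {m. finite {i. m i \<noteq> 0} \<and> {i. m i \<noteq> 0} \<subseteq> J}"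
    by blast
  ultimately show ?thesis by (rule countable_subset[rotated])
qed

text \<open>As a polynomial in \<open>t\<close>, the coefficient of \<open>t ^ k\<close> is the value at \<open>y\<close> of the part of \<open>c\<close> of degree
  \<open>k\<close> in the variable \<open>i\<close>, so it is nonzero as soon as that part is.\<close>

lemma alg_indep_rat_finite_roots:
  fixes c :: "('i \<Rightarrow> nat) \<Rightarrow> rat"
  assumes fin: "finite I" and i: "i \<notin> I" and y: "alg_indep_rat I y"
    and c: "finite {m. c m \<noteq> 0}" "\<forall>m. c m \<noteq> 0 \<longrightarrow> (\<forall>j. j \<notin> insert i I \<longrightarrow> m j = 0)"
    and nz: "c m0 \<noteq> 0"
  shows "finite {t. (\<Sum>m\<in>{m. c m \<noteq> 0}. of_rat (c m) * (\<Prod>j\<in>insert i I. (y(i := t)) j ^ m j)) = 0}"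
proof -
  let ?S = "{m. c m \<noteq> 0}"
  define N where "N = Max ((\<lambda>m. m i) ` ?S)"
  define A :: "nat \<Rightarrow> real" where "A = (\<lambda>k. \<Sum>m\<in>{m\<in>?S. m i = k}. of_rat (c m) * (\<Prod>j\<in>I. y j ^ m j))"
  have N: "m i \<le> N" if "m \<in> ?S" for m
    unfolding N_def using c(1) that by (intro Max_ge) auto
  have poly: "(\<Sum>m\<in>?S. of_rat (c m) * (\<Prod>j\<in>insert i I. (y(i := t)) j ^ m j)) = (\<Sum>k\<le>N. A k * t ^ k)" for t
  proof -
    have pr: "(\<Prod>j\<in>insert i I. (y(i := t)) j ^ m j) = (\<Prod>j\<in>I. y j ^ m j) * t ^ m i" for m
    proof -
      have "(\<Prod>j\<in>I. (y(i := t)) j ^ m j) = (\<Prod>j\<in>I. y j ^ m j)"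
        using i by (intro prod.cong) auto
      then show ?thesis using fin i by simp
    qed
    have "(\<Sum>k\<le>N. A k * t ^ k) = (\<Sum>k\<le>N. \<Sum>m\<in>{m\<in>?S. m i = k}. of_rat (c m) * (\<Prod>j\<in>I. y j ^ m j) * t ^ m i)"
      unfolding A_def sum_distrib_right by (intro sum.cong) auto
    also have "\<dots> = (\<Sum>m\<in>?S. of_rat (c m) * (\<Prod>j\<in>I. y j ^ m j) * t ^ m i)"
      by (rule sum.group) (use c(1) N in auto)
    finally show ?thesis unfolding pr by (simp add: mult.assoc)
  qed
  define k where "k = m0 i"
  \<comment> \<open>The coefficient of t ^ k, with k taken from m0 so that it is not the zero
    polynomial. The exponent of i is reset to 0, so independence of y over I applies.\<close>
  define c' where "c' = (\<lambda>m. if m i = 0 then c (m(i := k)) else 0)"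
  have supp: "{m. c' m \<noteq> 0} \<subseteq> (\<lambda>m. m(i := 0)) ` ?S"
  proof
    fix m assume "m \<in> {m. c' m \<noteq> 0}"
    then have "m i = 0" "m(i := k) \<in> ?S" unfolding c'_def by (auto split: if_splits)
    then have "m = (\<lambda>m. m(i := 0)) (m(i := k))" by auto
    then show "m \<in> (\<lambda>m. m(i := 0)) ` ?S" using \<open>m(i := k) \<in> ?S\<close> by blast
  qed
  have fin': "finite {m. c' m \<noteq> 0}" using supp c(1) by (meson finite_surj)
  have supp': "\<forall>m. c' m \<noteq> 0 \<longrightarrow> (\<forall>j. j \<notin> I \<longrightarrow> m j = 0)"
  proof (intro allI impI)
    fix m j assume m: "c' m \<noteq> 0" and j: "j \<notin> I"
    then have mi: "m i = 0" "c (m(i := k)) \<noteq> 0" unfolding c'_def by (auto split: if_splits)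
    show "m j = 0"
    proof (cases "j = i")
      case False
      then have "(m(i := k)) j = 0" using c(2) mi(2) j by blast
      then show ?thesis using False by simp
    qed (use mi in simp)
  qed
  have nz': "c' (m0(i := 0)) \<noteq> 0" unfolding c'_def k_def using nz by simp
  have "(\<Sum>m\<in>{m. c' m \<noteq> 0}. of_rat (c' m) * (\<Prod>j\<in>I. y j ^ m j)) \<noteq> 0"
  proof
    assume "(\<Sum>m\<in>{m. c' m \<noteq> 0}. of_rat (c' m) * (\<Prod>j\<in>I. y j ^ m j)) = 0"
    then have "\<forall>m. c' m = 0"
      using y[unfolded alg_indep_rat_def, rule_format, of c'] fin' supp' by blast
    then show False using nz' by simp
  qed
  also have "(\<Sum>m\<in>{m. c' m \<noteq> 0}. of_rat (c' m) * (\<Prod>j\<in>I. y j ^ m j)) = A k"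
    unfolding A_def
  proof (rule sum.reindex_bij_witness[of _ "\<lambda>m. m(i := 0)" "\<lambda>m. m(i := k)"])
    fix m assume "m \<in> {m. c' m \<noteq> 0}"
    then have m: "m i = 0" "c (m(i := k)) \<noteq> 0" unfolding c'_def by (auto split: if_splits)
    have "(\<Prod>j\<in>I. y j ^ (m(i := k)) j) = (\<Prod>j\<in>I. y j ^ m j)"
      using i by (intro prod.cong) auto
    then show "of_rat (c (m(i := k))) * (\<Prod>j\<in>I. y j ^ (m(i := k)) j) = of_rat (c' m) * (\<Prod>j\<in>I. y j ^ m j)"
      using m by (simp add: c'_def)
    show "(m(i := k))(i := 0) = m" using m by auto
    show "m(i := k) \<in> {m \<in> ?S. m i = k}" using m by simp
  next
    fix m assume m: "m \<in> {m \<in> ?S. m i = k}"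
    then show "(m(i := 0))(i := k) = m" by auto
    have "m(i := k) = m" using m by auto
    then show "m(i := 0) \<in> {m. c' m \<noteq> 0}" using m by (simp add: c'_def)
  qed
  finally have "A k \<noteq> 0" .
  moreover have "k \<le> N" unfolding k_def using N nz by simp
  ultimately show ?thesis unfolding poly using polyfun_finite_roots[of A N] by blast
qed

text \<open>The values are chosen one index at a time: each of the countably many nonzero rational
  polynomials excludes finitely many t, while the allowed interval is uncountable.\<close>

lemma alg_indep_rat_dense:
  assumes "finite I" "\<epsilon> > 0"
  shows "\<exists>y. alg_indep_rat I y \<and> (\<forall>i\<in>I. \<bar>y i - z i\<bar> < \<epsilon>)"
  using assms(1)
proof (induction I rule: finite_induct)
  case empty
  \<comment> \<open>Without variables the zero exponent is the only monomial, so polynomials are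
    rational constants.\<close>
  have "alg_indep_rat {} z"
    unfolding alg_indep_rat_def
  proof (intro allI impI)
    fix c :: "('a \<Rightarrow> nat) \<Rightarrow> rat" and m
    assume *: "finite {m. c m \<noteq> 0} \<and> (\<forall>m. c m \<noteq> 0 \<longrightarrow> (\<forall>i. i \<notin> {} \<longrightarrow> m i = 0)) \<and>
      (\<Sum>m | c m \<noteq> 0. real_of_rat (c m) * (\<Prod>i\<in>{}. z i ^ m i)) = 0"
    show "c m = 0"
    proof (rule ccontr)
      assume m: "c m \<noteq> 0"
      have "m' = m" if "c m' \<noteq> 0" for m'
      proof
        fix i show "m' i = m i" using * m that by (metis empty_iff)
      qed
      then have "{m. c m \<noteq> 0} = {m}" using m by blast
      then show False using * m by simp
    qed
  qed
  then show ?case by auto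
next
  case (insert i I)
  then obtain y where y: "alg_indep_rat I y" "\<forall>i\<in>I. \<bar>y i - z i\<bar> < \<epsilon>" by blast
  let ?val = "\<lambda>(c :: ('a \<Rightarrow> nat) \<Rightarrow> rat) t. \<Sum>m\<in>{m. c m \<noteq> 0}. real_of_rat (c m) * (\<Prod>j\<in>insert i I. (y(i := t)) j ^ m j)"
  let ?C = "{c :: ('a \<Rightarrow> nat) \<Rightarrow> rat. finite {m. c m \<noteq> 0} \<and> {m. c m \<noteq> 0} \<subseteq> {m. \<forall>j. j \<notin> insert i I \<longrightarrow> m j = 0}}"
  define B where "B = (\<Union>c\<in>?C - {\<lambda>_. 0}. {t. ?val c t = 0})"
  have C: "countable ?C"
    using insert.hyps by (intro countable_finite_support_fun countable_exponents) simp
  have cB: "countable B"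
    unfolding B_def
  proof (intro countable_UN countable_Diff C countable_finite)
    fix c assume c: "c \<in> ?C - {\<lambda>_. 0}"
    then obtain m0 where m0: "c m0 \<noteq> 0" by fastforce
    have "finite {m. c m \<noteq> 0}" "\<forall>m. c m \<noteq> 0 \<longrightarrow> (\<forall>j. j \<notin> insert i I \<longrightarrow> m j = 0)"
      using c by blast+
    then show "finite {t. ?val c t = 0}"
      using m0 by (rule alg_indep_rat_finite_roots[OF insert.hyps y(1)])
  qed
  have "uncountable {z i - \<epsilon><..<z i + \<epsilon>}"
    using assms(2) by (simp add: uncountable_open_interval)
  then have "\<not> {z i - \<epsilon><..<z i + \<epsilon>} \<subseteq> B" using countable_subset[OF _ cB] by metis
  then obtain t where t: "t \<in> {z i - \<epsilon><..<z i + \<epsilon>}" "t \<notin> B" by (auto simp only: subset_iff)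
  have "alg_indep_rat (insert i I) (y(i := t))"
    unfolding alg_indep_rat_def
  proof (intro allI impI)
    fix c :: "('a \<Rightarrow> nat) \<Rightarrow> rat" and m
    assume *: "finite {m. c m \<noteq> 0} \<and> (\<forall>m. c m \<noteq> 0 \<longrightarrow> (\<forall>j. j \<notin> insert i I \<longrightarrow> m j = 0)) \<and> ?val c t = 0"
    then have c: "c \<in> ?C" by auto
    have "c = (\<lambda>_. 0)"
    proof (rule ccontr)
      assume "c \<noteq> (\<lambda>_. 0)"
      then have "c \<in> ?C - {\<lambda>_. 0}" using c by simp
      moreover have "t \<in> {t. ?val c t = 0}" using * by simp
      ultimately have "t \<in> B" unfolding B_def by (intro UN_I[of c])
      then show False using t(2) by contradiction
    qed
    then show "c m = 0" by simp
  qed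
  moreover have "\<forall>j\<in>insert i I. \<bar>(y(i := t)) j - z j\<bar> < \<epsilon>"
    using y(2) t(1) insert.hyps by (auto simp: abs_less_iff)
  ultimately show ?case by blast
qed

section \<open>Infinitesimal rigidity implies rigidity\<close>

lemma dist_vec2: "dist (u :: real^2) v = sqrt ((u $ 1 - v $ 1)\<^sup>2 + (u $ 2 - v $ 2)\<^sup>2)"
  by (simp add: dist_vec_def L2_set_def sum_2 dist_real_def)

text \<open>In coordinates \<open>(\<alpha>, \<beta>)\<close> that move with an edge \<open>ab\<close>, a motion of the framework keeps \<open>a\<close> and \<open>b\<close> fixed.
  If \<open>x\<close> and \<open>y\<close> have the same edge lengths, then \<open>x - y\<close> is an infinitesimal motion of \<open>(x + y) / 2\<close>, so
  the moving coordinates cannot leave their initial values without a jump.\<close>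

lemma rigid_framework_of_inf_rigid:
  fixes p :: "'a \<Rightarrow> real^2"
  assumes fin: "finite V" and r: "inf_rigid V E (\<lambda>v. p v $ 1) (\<lambda>v. p v $ 2)"
  shows "rigid_framework V E p"
proof (cases "\<forall>u\<in>V. \<forall>v\<in>V. u = v")
  case True
  then show ?thesis unfolding rigid_framework_def by (metis dist_self)
next
  case False
  then obtain a b where ab: "a \<in> V" "b \<in> V" "{a, b} \<in> E" "p a $ 1 \<noteq> p b $ 1 \<or> p a $ 2 \<noteq> p b $ 2"
    using inf_rigid_edge[OF r] by metis
  define D where "D = (p b $ 1 - p a $ 1)\<^sup>2 + (p b $ 2 - p a $ 2)\<^sup>2"
  have D: "D > 0"
    using ab(4) unfolding D_def by (metis eq_iff_diff_eq_0 sum_power2_gt_zero_iff)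
  show ?thesis
    unfolding rigid_framework_def
  proof (intro allI impI ballI)
    fix x :: "real \<Rightarrow> 'a \<Rightarrow> real^2" and t0 :: real and u0 v0
    assume *: "(\<forall>v\<in>V. continuous_on {0..1} (\<lambda>t. x t v)) \<and> (\<forall>v\<in>V. x 0 v = p v) \<and>
      (\<forall>t\<in>{0..1}. \<forall>u\<in>V. \<forall>v\<in>V. {u, v} \<in> E \<longrightarrow> dist (x t u) (x t v) = dist (p u) (p v))"
    assume t0: "t0 \<in> {0..1}" and u0: "u0 \<in> V" and v0: "v0 \<in> V"
    define L where "L = (\<lambda>t u v. (x t u $ 1 - x t v $ 1)\<^sup>2 + (x t u $ 2 - x t v $ 2)\<^sup>2)"
    have dL: "dist (x t u) (x t v) = sqrt (L t u v)" for t u v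
      unfolding L_def by (rule dist_vec2)
    have init: "x 0 v = p v" if "v \<in> V" for v using * that by blast
    have edge: "L t u v = L 0 u v" if "t \<in> {0..1}" "u \<in> V" "v \<in> V" "{u, v} \<in> E" for t u v
    proof -
      have "dist (x t u) (x t v) = dist (x 0 u) (x 0 v)" using * that init by metis
      then show ?thesis unfolding dL by simp
    qed
    \<comment> \<open>In complex notation \<alpha> + i \<beta> is (x v - x a) / (x b - x a); the
      squared modulus of the denominator stays D because ab is an edge.\<close>
    define \<alpha> where "\<alpha> = (\<lambda>t v. ((x t v $ 1 - x t a $ 1) * (x t b $ 1 - x t a $ 1)
      + (x t v $ 2 - x t a $ 2) * (x t b $ 2 - x t a $ 2)) / D)"
    define \<beta> where "\<beta> = (\<lambda>t v. ((x t v $ 2 - x t a $ 2) * (x t b $ 1 - x t a $ 1)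
      - (x t v $ 1 - x t a $ 1) * (x t b $ 2 - x t a $ 2)) / D)"
    have Lba: "L t b a = D" if "t \<in> {0..1}" for t
    proof -
      have "L t b a = L 0 b a" using ab that by (intro edge) (auto simp: insert_commute)
      also have "\<dots> = D" unfolding L_def D_def by (simp add: init ab)
      finally show ?thesis .
    qed
    have N: "(\<alpha> t u - \<alpha> t v)\<^sup>2 + (\<beta> t u - \<beta> t v)\<^sup>2 = L t u v / D" if "t \<in> {0..1}" for t u v
    proof -
      have du: "\<alpha> t u - \<alpha> t v = ((x t u $ 1 - x t v $ 1) * (x t b $ 1 - x t a $ 1)
          + (x t u $ 2 - x t v $ 2) * (x t b $ 2 - x t a $ 2)) / D"
        "\<beta> t u - \<beta> t v = ((x t u $ 2 - x t v $ 2) * (x t b $ 1 - x t a $ 1)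
          - (x t u $ 1 - x t v $ 1) * (x t b $ 2 - x t a $ 2)) / D"
        unfolding \<alpha>_def \<beta>_def by (simp_all add: diff_divide_distrib[symmetric] algebra_simps)
      have "(\<alpha> t u - \<alpha> t v)\<^sup>2 + (\<beta> t u - \<beta> t v)\<^sup>2 = L t u v * L t b a / D\<^sup>2"
        unfolding du L_def power_divide add_divide_distrib[symmetric]
        by (simp add: power2_eq_square algebra_simps)
      then show ?thesis using Lba[OF that] D by (simp add: power2_eq_square)
    qed
    have base: "\<alpha> t a = 0" "\<beta> t a = 0" for t unfolding \<alpha>_def \<beta>_def by simp_all
    have tip: "\<alpha> t b = 1" if "t \<in> {0..1}" for t
      using Lba[OF that] D unfolding \<alpha>_def L_def by (simp add: power2_eq_square)
    have "inf_rigid V E (\<alpha> 0) (\<beta> 0)"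
    proof -
      let ?c = "(p b $ 1 - p a $ 1) / D" and ?s = "(p b $ 2 - p a $ 2) / D"
      have "?c * ?c - ?s * - ?s = D / (D * D)"
        unfolding D_def by (simp add: power2_eq_square add_divide_distrib)
      then have "inf_rigid V E (\<lambda>v. ?c * p v $ 1 + ?s * p v $ 2 + (- ?c * p a $ 1 - ?s * p a $ 2))
          (\<lambda>v. - ?s * p v $ 1 + ?c * p v $ 2 + (?s * p a $ 1 - ?c * p a $ 2))"
        using D by (intro inf_rigid_affine[OF r]) simp
      then show ?thesis
        by (rule inf_rigid_cong[THEN iffD1, rotated 2])
          (use ab in \<open>simp_all add: \<alpha>_def \<beta>_def init diff_divide_distrib add_divide_distrib algebra_simps\<close>)
    qed
    then obtain \<epsilon> where \<epsilon>: "\<epsilon> > 0"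
        "\<And>X Y. (\<forall>v\<in>V. \<bar>X v - \<alpha> 0 v\<bar> < \<epsilon> \<and> \<bar>Y v - \<beta> 0 v\<bar> < \<epsilon>) \<Longrightarrow> inf_rigid V E X Y"
      using inf_rigid_stable[OF fin] by blast
    define h where "h = (\<lambda>t. \<Sum>v\<in>V. \<bar>\<alpha> t v - \<alpha> 0 v\<bar> + \<bar>\<beta> t v - \<beta> 0 v\<bar>)"
    have le_h: "\<bar>\<alpha> t v - \<alpha> 0 v\<bar> + \<bar>\<beta> t v - \<beta> 0 v\<bar> \<le> h t" if "v \<in> V" for t v
      unfolding h_def using fin that by (intro member_le_sum) auto
    \<comment> \<open>Thus h takes no value strictly between 0 and \<epsilon>; being continuous with
      h 0 = 0, it cannot pass \<epsilon> / 2.\<close>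
    have gap: "h t = 0" if t: "t \<in> {0..1}" and small: "h t < \<epsilon>" for t
    proof -
      define f g where "f = (\<lambda>v. \<alpha> t v - \<alpha> 0 v)" and "g = (\<lambda>v. \<beta> t v - \<beta> 0 v)"
      define X Y where "X = (\<lambda>v. (\<alpha> t v + \<alpha> 0 v) / 2)" and "Y = (\<lambda>v. (\<beta> t v + \<beta> 0 v) / 2)"
      have "\<bar>X v - \<alpha> 0 v\<bar> < \<epsilon> \<and> \<bar>Y v - \<beta> 0 v\<bar> < \<epsilon>" if "v \<in> V" for v
      proof -
        have "X v - \<alpha> 0 v = (\<alpha> t v - \<alpha> 0 v) / 2" "Y v - \<beta> 0 v = (\<beta> t v - \<beta> 0 v) / 2"
          unfolding X_def Y_def by (simp_all add: field_simps)
        then have eqs: "\<bar>X v - \<alpha> 0 v\<bar> = \<bar>\<alpha> t v - \<alpha> 0 v\<bar> / 2" "\<bar>Y v - \<beta> 0 v\<bar> = \<bar>\<beta> t v - \<beta> 0 v\<bar> / 2"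
          by (simp_all only: abs_divide abs_numeral)
        have "\<bar>\<alpha> t v - \<alpha> 0 v\<bar> < \<epsilon>" "\<bar>\<beta> t v - \<beta> 0 v\<bar> < \<epsilon>"
          using le_h[OF that, of t] small by linarith+
        then show ?thesis unfolding eqs using \<epsilon>(1) by simp
      qed
      then have rXY: "inf_rigid V E X Y" by (intro \<epsilon>(2)) blast
      have m: "inf_motion V E X Y f g"
        unfolding inf_motion_def
      proof (intro ballI impI)
        fix u v assume uv: "u \<in> V" "v \<in> V" "{u, v} \<in> E"
        have "2 * ((X u - X v) * (f u - f v) + (Y u - Y v) * (g u - g v)) =
            ((\<alpha> t u - \<alpha> t v)\<^sup>2 + (\<beta> t u - \<beta> t v)\<^sup>2) - ((\<alpha> 0 u - \<alpha> 0 v)\<^sup>2 + (\<beta> 0 u - \<beta> 0 v)\<^sup>2)"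
          unfolding X_def Y_def f_def g_def by (simp add: power2_eq_square field_simps)
        also have "\<dots> = 0" using edge[OF t uv] t by (simp add: N)
        finally show "(X u - X v) * (f u - f v) + (Y u - Y v) * (g u - g v) = 0" by simp
      qed
      obtain s c w where st: "\<forall>v\<in>V. f v = s - w * Y v \<and> g v = c + w * X v"
        using inf_rigidD[OF rXY m] by blast
      \<comment> \<open>In the mean framework a is at (0,0) and b at (1,0), and neither moves, so
        the trivial motion is zero.\<close>
      have "f a = 0" "g a = 0" "X a = 0" "Y a = 0" "f b = 0" "X b = 1"
        unfolding f_def g_def X_def Y_def using base tip t by simp_all
      moreover have "\<beta> t b = 0" for t unfolding \<beta>_def by simp
      then have "g b = 0" unfolding g_def by simp
      ultimately have "s = 0" "c = 0" "w = 0" using st ab(1,2) by fastforce+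
      then have "f v = 0" "g v = 0" if "v \<in> V" for v using st that by auto
      then show ?thesis unfolding h_def f_def g_def by simp
    qed
    have cx: "continuous_on {0..1} (\<lambda>t. x t v $ i)" if "v \<in> V" for v i
      using * that by (intro continuous_on_component) blast
    have "continuous_on {0..1} (\<lambda>t. \<alpha> t v)" "continuous_on {0..1} (\<lambda>t. \<beta> t v)" if "v \<in> V" for v
      unfolding \<alpha>_def \<beta>_def using D
      by (intro continuous_on_divide continuous_on_add continuous_on_diff continuous_on_mult
          continuous_on_const cx ab that; simp)+
    then have "continuous_on {0..1} h"
      unfolding h_def
      by (intro continuous_on_sum continuous_on_add continuous_on_rabs continuous_on_diff continuous_on_const)
    then have ch: "continuous_on {0..t0} h" using t0 by (auto intro: continuous_on_subset)
    have "h t0 < \<epsilon>"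
    proof (rule ccontr)
      assume "\<not> h t0 < \<epsilon>"
      moreover have "h 0 = 0" unfolding h_def by simp
      ultimately obtain t where "0 \<le> t" "t \<le> t0" "h t = \<epsilon> / 2"
        using IVT'[of h 0 "\<epsilon> / 2" t0] ch t0 \<epsilon>(1) by auto
      then show False using gap[of t] t0 \<epsilon>(1) by auto
    qed
    then have h0: "h t0 = 0" using gap t0 by blast
    have same: "\<alpha> t0 v = \<alpha> 0 v" "\<beta> t0 v = \<beta> 0 v" if "v \<in> V" for v
      using le_h[OF that, of t0] unfolding h0 by simp_all
    have "L t0 u0 v0 / D = L 0 u0 v0 / D"
      unfolding N[OF t0, symmetric] using N[of 0 u0 v0] same u0 v0 by simp
    then have "dist (x t0 u0) (x t0 v0) = dist (x 0 u0) (x 0 v0)" using D unfolding dL by simp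
    then show "dist (x t0 u0) (x t0 v0) = dist (p u0) (p v0)" using init u0 v0 by simp
  qed
qed

lemma rigid_in_R2_of_realizable:
  assumes fin: "finite V" and r: "realizable V E"
  shows "rigid_in_R2 V E"
proof -
  obtain X Y where "inf_rigid V E X Y" using r unfolding realizable_def by blast
  then obtain \<epsilon> where \<epsilon>: "\<epsilon> > 0"
      "\<And>X' Y'. (\<forall>v\<in>V. \<bar>X' v - X v\<bar> < \<epsilon> \<and> \<bar>Y' v - Y v\<bar> < \<epsilon>) \<Longrightarrow> inf_rigid V E X' Y'"
    using inf_rigid_stable[OF fin] by blast
  define z where "z = (\<lambda>(v, i :: 2). if i = 1 then X v else Y v)"
  have "finite (V \<times> (UNIV :: 2 set))" using fin by simp
  then obtain y where y: "alg_indep_rat (V \<times> (UNIV :: 2 set)) y"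
      "\<forall>i\<in>V \<times> (UNIV :: 2 set). \<bar>y i - z i\<bar> < \<epsilon>"
    using alg_indep_rat_dense \<epsilon>(1) by blast
  define p :: "'a \<Rightarrow> real^2" where "p = (\<lambda>v. \<chi> i. y (v, i))"
  have "(\<lambda>(v, i). p v $ i) = y" unfolding p_def by auto
  then have "generic_framework V p" unfolding generic_framework_def using y(1) by simp
  moreover have "\<bar>p v $ 1 - X v\<bar> < \<epsilon> \<and> \<bar>p v $ 2 - Y v\<bar> < \<epsilon>" if "v \<in> V" for v
    using y(2)[rule_format, of "(v, 1)"] y(2)[rule_format, of "(v, 2)"] that
    by (simp add: p_def z_def)
  then have "inf_rigid V E (\<lambda>v. p v $ 1) (\<lambda>v. p v $ 2)" by (intro \<epsilon>(2)) blast
  then have "rigid_framework V E p" by (rule rigid_framework_of_inf_rigid[OF fin])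
  ultimately show ?thesis unfolding rigid_in_R2_def by blast
qed

section \<open>Ore graphs\<close>

definition ore :: "'a set \<Rightarrow> 'a set set \<Rightarrow> bool" where
  "ore V E \<longleftrightarrow> (\<forall>u\<in>V. \<forall>v\<in>V. u \<noteq> v \<and> {u, v} \<notin> E \<longrightarrow> card V \<le> degree V E u + degree V E v)"

lemma oreD: "ore V E \<Longrightarrow> u \<in> V \<Longrightarrow> v \<in> V \<Longrightarrow> u \<noteq> v \<Longrightarrow> {u, v} \<notin> E \<Longrightarrow> card V \<le> degree V E u + degree V E v"
  unfolding ore_def by blast

lemma degree_Un:
  assumes "finite H" "finite W" "H \<inter> W = {}"
  shows "degree (H \<union> W) E v = degree H E v + degree W E v"
proof -
  have "{u \<in> H \<union> W. {u, v} \<in> E} = {u \<in> H. {u, v} \<in> E} \<union> {u \<in> W. {u, v} \<in> E}" by blast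
  then show ?thesis unfolding degree_def using assms by (simp add: card_Un_disjoint disjoint_iff)
qed

lemma degree_eq_0:
  assumes "\<And>u. u \<in> V \<Longrightarrow> {u, v} \<notin> E"
  shows "degree V E v = 0"
proof -
  have "{u \<in> V. {u, v} \<in> E} = {}" using assms by blast
  then show ?thesis unfolding degree_def by (simp only: card.empty)
qed

lemma degree_less_card:
  assumes "finite V" "v \<in> V" "{v} \<notin> E"
  shows "degree V E v < card V"
proof -
  have "v \<notin> {u \<in> V. {u, v} \<in> E}" using assms(3) by simp
  then have "{u \<in> V. {u, v} \<in> E} \<subset> V" using assms(2) by blast
  then show ?thesis unfolding degree_def using assms(1) by (intro psubset_card_mono)
qed

lemma sum_degree_swap:
  assumes "finite H" "finite W"
  shows "(\<Sum>y\<in>H. degree W E y) = (\<Sum>x\<in>W. degree H E x)"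
proof -
  have deg: "degree A E v = (\<Sum>u\<in>A. if {u, v} \<in> E then 1 else 0)" if "finite A" for A v
    using that unfolding degree_def by (simp add: sum.If_cases Int_def)
  show ?thesis
    unfolding deg[OF assms(1)] deg[OF assms(2)]
    by (subst sum.swap) (simp add: insert_commute)
qed

text \<open>The neighbourhood of a vertex of maximum degree is independent, so the degree condition for two of
  its elements forces it to have size at most \<open>card V / 2\<close>; hence all inequalities are equalities.\<close>

lemma ore_triangle_free:
  assumes fin: "finite V" and ore: "ore V E"
    and tf: "\<And>a b c. a \<in> V \<Longrightarrow> b \<in> V \<Longrightarrow> c \<in> V \<Longrightarrow> {a, b} \<in> E \<Longrightarrow> {b, c} \<in> E \<Longrightarrow> {a, c} \<notin> E"
    and xy: "x \<in> V" "y \<in> V" "x \<noteq> y" "{x, y} \<notin> E" and n: "card V \<ge> 4"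
  shows "\<exists>N\<subseteq>V. 2 * card N = card V \<and> (\<forall>u\<in>N. \<forall>v\<in>V - N. {u, v} \<in> E)"
proof -
  define \<Delta> where "\<Delta> = Max (degree V E ` V)"
  have le: "degree V E v \<le> \<Delta>" if "v \<in> V" for v
    unfolding \<Delta>_def using fin that by (intro Max_ge) auto
  have "\<Delta> \<in> degree V E ` V" unfolding \<Delta>_def using fin xy by (intro Max_in) auto
  then obtain a where a: "a \<in> V" "degree V E a = \<Delta>" by auto
  define N where "N = {u \<in> V. {u, a} \<in> E}"
  have NV: "N \<subseteq> V" and finN: "finite N" and cardN: "card N = \<Delta>"
    using fin a(2) unfolding N_def degree_def by auto
  have half: "card V \<le> 2 * \<Delta>" using oreD[OF ore xy] le[OF xy(1)] le[OF xy(2)] by linarith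
  have cardVN: "card (V - N) = card V - \<Delta>" using NV finN cardN by (simp add: card_Diff_subset)
  have indep: "{u, v} \<notin> E" if "u \<in> N" "v \<in> N" for u v
    using tf[of u a v] that a(1) unfolding N_def by (auto simp: insert_commute)
  have sub: "{w \<in> V. {w, u} \<in> E} \<subseteq> V - N" if "u \<in> N" for u
    using indep that by auto
  have deg: "degree V E u \<le> card V - \<Delta>" if "u \<in> N" for u
    unfolding degree_def cardVN[symmetric] using sub[OF that] fin by (intro card_mono) auto
  \<comment> \<open>At least four vertices give \<Delta> \<ge> 2, so every element of the
    independent set N has a non-adjacent partner.\<close>
  have other: "\<exists>v\<in>N. v \<noteq> u" if "u \<in> N" for u
  proof (rule ccontr)
    assume "\<not> ?thesis"
    then have "N \<subseteq> {u}" by blast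
    then have "card N \<le> 1" using card_mono[of "{u}" N] by simp
    then show False using cardN half n by linarith
  qed
  have sum: "card V \<le> degree V E u + (card V - \<Delta>)" if u: "u \<in> N" for u
  proof -
    obtain v where v: "v \<in> N" "v \<noteq> u" using other[OF u] by blast
    then have "card V \<le> degree V E u + degree V E v"
      using oreD[OF ore, of u v] indep u NV by blast
    then show ?thesis using deg[OF v(1)] by linarith
  qed
  have "N \<noteq> {}" using cardN half n by fastforce
  then obtain u where u: "u \<in> N" by blast
  have n2: "card V = 2 * \<Delta>" using sum[OF u] deg[OF u] half n by arith
  have "{w \<in> V. {w, u} \<in> E} = V - N" if u: "u \<in> N" for u
  proof (rule card_subset_eq)
    have "degree V E u = card V - \<Delta>" using sum[OF u] deg[OF u] n2 by linarith
    then show "card {w \<in> V. {w, u} \<in> E} = card (V - N)" unfolding degree_def cardVN .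
  qed (use fin sub[OF u] in auto)
  then have "{u, v} \<in> E" if "u \<in> N" "v \<in> V - N" for u v
    using that by (auto simp: insert_commute)
  then show ?thesis using NV cardN n2 by (intro exI[of _ N]) simp
qed

text \<open>Induction on the number of vertices. Let \<open>H\<close> be a realizable set of maximum size and \<open>W = V - H\<close>.
  A vertex of \<open>W\<close> has at most one neighbour in \<open>H\<close>, and then every vertex of \<open>H\<close> has a neighbour in
  \<open>W\<close>. If \<open>card H \<ge> 3\<close>, then \<open>W\<close> satisfies the degree condition strictly and is joined to \<open>H\<close> by three
  disjoint edges. Otherwise there is no triangle, so the graph contains \<open>K\<^sub>m\<^sub>,\<^sub>m\<close> with \<open>2m\<close> its order.\<close>

theorem ore_realizable:
  assumes "finite V" "\<And>v. {v} \<notin> E" "ore V E"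
  shows "realizable V E \<or> (\<exists>a b c d. distinct [a, b, c, d] \<and> V = {a, b, c, d} \<and>
    {a, b} \<in> E \<and> {b, c} \<in> E \<and> {c, d} \<in> E \<and> {d, a} \<in> E \<and> {a, c} \<notin> E \<and> {b, d} \<notin> E)"
  using assms
proof (induction "card V" arbitrary: V rule: less_induct)
  case less
  note fin = less.prems(1) and loop = less.prems(2) and ore = less.prems(3)
  show ?case
  proof (cases "realizable V E \<or> (\<forall>u\<in>V. \<forall>v\<in>V. u = v)")
    case True
    then show ?thesis using inf_rigid_subsingleton unfolding realizable_def by blast
  next
    case False
    then obtain u v where uv: "u \<in> V" "v \<in> V" "u \<noteq> v" by blast
    have nV: "\<not> realizable V E" using False by blast
    have "\<exists>a\<in>V. \<exists>b\<in>V. {a, b} \<in> E"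
    proof (rule ccontr)
      assume none: "\<not> ?thesis"
      have "degree V E w = 0" if "w \<in> V" for w
        using none that by (intro degree_eq_0) blast
      then have "card V = 0" using oreD[OF ore uv] none uv by auto
      then show False using fin uv by auto
    qed
    then obtain a0 b0 where e0: "a0 \<in> V" "b0 \<in> V" "{a0, b0} \<in> E" by blast
    then have "a0 \<noteq> b0" using loop by auto
    define S where "S = {H. H \<subseteq> V \<and> realizable H E}"
    have finS: "finite S" unfolding S_def using fin by simp
    have S0: "{a0, b0} \<in> S" unfolding S_def using e0 realizable_edge[OF e0(3) \<open>a0 \<noteq> b0\<close>] by blast
    have "Max (card ` S) \<in> card ` S" using finS S0 by (intro Max_in) auto
    then obtain H where HS: "H \<in> S" and "card H = Max (card ` S)" by auto
    then have Hmax: "card H' \<le> card H" if "H' \<in> S" for H' using finS that by simp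
    have HV: "H \<subseteq> V" and Hr: "realizable H E" using HS unfolding S_def by auto
    have finH: "finite H" using HV fin by (rule finite_subset)
    have h2: "card H \<ge> 2" using Hmax[OF S0] \<open>a0 \<noteq> b0\<close> by simp
    define W where "W = V - H"
    have finW: "finite W" and disj: "H \<inter> W = {}" and V: "V = H \<union> W" and WV: "W \<subseteq> V"
      unfolding W_def using fin HV by auto
    have "W \<noteq> {}" using nV Hr V by auto
    have cV: "card V = card H + card W" unfolding V using finH finW disj by (rule card_Un_disjoint)
    have dV: "degree V E v = degree H E v + degree W E v" for v
      unfolding V using finH finW disj by (rule degree_Un)
    have uniq: "a = b" if "x \<in> W" "a \<in> H" "b \<in> H" "{a, x} \<in> E" "{b, x} \<in> E" for x a b
    proof (rule ccontr)
      have xH: "x \<notin> H" using that(1) disj by blast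
      assume "a \<noteq> b"
      then have "realizable (insert x H) E"
        using that xH by (intro realizable_insert[OF finH Hr, of x a b]) auto
      then have "insert x H \<in> S" unfolding S_def using that WV HV by auto
      then show False using Hmax[of "insert x H"] finH xH by simp
    qed
    have dH1: "degree H E x \<le> 1" if "x \<in> W" for x
    proof -
      have "card {u \<in> H. {u, x} \<in> E} \<le> Suc 0"
        using finH uniq[OF that] by (subst card_le_Suc0_iff_eq) auto
      then show ?thesis unfolding degree_def by simp
    qed
    have dlH: "degree H E y < card H" if "y \<in> H" for y
      using degree_less_card[OF finH that loop] .
    have dlW: "degree W E x < card W" if "x \<in> W" for x
      using degree_less_card[OF finW that loop] .
    have sumW: "(\<Sum>y\<in>H. degree W E y) \<le> card W"
    proof -
      have "(\<Sum>y\<in>H. degree W E y) = (\<Sum>x\<in>W. degree H E x)" using finH finW by (rule sum_degree_swap)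
      also have "\<dots> \<le> (\<Sum>x\<in>W. 1)" using dH1 by (intro sum_mono) auto
      finally show ?thesis by simp
    qed
    \<comment> \<open>Inside H the two degrees sum to at most 1 + (card H - 1), so card H cancels
      from the degree condition of V.\<close>
    have key: "card W \<le> degree W E x + degree W E y" if "x \<in> W" "y \<in> H" "{y, x} \<notin> E" for x y
    proof -
      have "card V \<le> degree V E x + degree V E y"
        using that disj HV WV by (intro oreD[OF ore]) (auto simp: insert_commute)
      then show ?thesis using dH1[OF that(1)] dlH[OF that(2)] unfolding dV cV by linarith
    qed
    \<comment> \<open>Otherwise \<open>key\<close> would give each x in W degree card W inside W,
      impossible without loops.\<close>
    have nb: "\<exists>x\<in>W. {y, x} \<in> E" if y: "y \<in> H" for y
    proof (rule ccontr)
      assume none: "\<not> ?thesis"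
      then have "degree W E y = 0" by (intro degree_eq_0) (simp add: insert_commute)
      moreover obtain x where x: "x \<in> W" using \<open>W \<noteq> {}\<close> by blast
      ultimately show False using key[OF x y] dlW[OF x] none by auto
    qed
    have dW1: "degree W E y \<ge> 1" if "y \<in> H" for y
    proof -
      obtain x where "x \<in> W" "{y, x} \<in> E" using nb[OF \<open>y \<in> H\<close>] by blast
      then have "{u \<in> W. {u, y} \<in> E} \<noteq> {}" by (auto simp: insert_commute)
      then have "card {u \<in> W. {u, y} \<in> E} > 0" using finW by (simp add: card_gt_0_iff)
      then show ?thesis unfolding degree_def by simp
    qed
    have hw: "card H \<le> card W"
    proof -
      have "card H = (\<Sum>y\<in>H. 1)" by simp
      also have "\<dots> \<le> (\<Sum>y\<in>H. degree W E y)" using dW1 by (intro sum_mono) auto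
      finally show ?thesis using sumW by linarith
    qed
    show ?thesis
    proof (cases "card H \<ge> 3")
      case True
      have pick: "\<exists>y\<in>H. y \<noteq> z \<and> {y, x} \<notin> E" if "x \<in> W" for x z
      proof (rule ccontr)
        assume "\<not> ?thesis"
        then have "H \<subseteq> insert z {u \<in> H. {u, x} \<in> E}" by blast
        then have "card H \<le> card (insert z {u \<in> H. {u, x} \<in> E})" using finH by (intro card_mono) auto
        also have "\<dots> \<le> Suc (card {u \<in> H. {u, x} \<in> E})" by (rule card_insert_le_m1) auto
        also have "\<dots> \<le> 2" using dH1[OF that] unfolding degree_def by simp
        finally show False using True by simp
      qed
      \<comment> \<open>Apply \<open>key\<close> to distinct non-neighbours y of x and y' of x'. At
        most card W edges leave H, and a third vertex z uses at least one, so y and y' together use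
        fewer than card W.\<close>
      have strict: "card W < degree W E x + degree W E x'" if "x \<in> W" "x' \<in> W" for x x'
      proof -
        obtain y where y: "y \<in> H" "{y, x} \<notin> E" using pick[OF \<open>x \<in> W\<close>] by blast
        obtain y' where y': "y' \<in> H" "y' \<noteq> y" "{y', x'} \<notin> E" using pick[OF \<open>x' \<in> W\<close>] by blast
        have "\<not> H \<subseteq> {y, y'}"
        proof
          assume "H \<subseteq> {y, y'}"
          then have "card H \<le> card {y, y'}" by (intro card_mono) auto
          then show False using True y'(2) by simp
        qed
        then obtain z where z: "z \<in> H" "z \<noteq> y" "z \<noteq> y'" by blast
        have "(\<Sum>v\<in>{y, y', z}. degree W E v) \<le> (\<Sum>v\<in>H. degree W E v)"
          using finH y y' z by (intro sum_mono2) auto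
        then have "degree W E y + degree W E y' + degree W E z \<le> card W"
          using sumW y y' z by auto
        then show ?thesis
          using key[OF that(1) y] key[OF that(2) y'(1,3)] dW1[OF z(1)] by linarith
      qed
      have "ore W E" unfolding ore_def using strict by (meson less_imp_le)
      moreover have "card W < card V" using h2 cV by simp
      ultimately have "realizable W E \<or> (\<exists>a b c d. distinct [a, b, c, d] \<and> W = {a, b, c, d} \<and>
          {a, b} \<in> E \<and> {b, c} \<in> E \<and> {c, d} \<in> E \<and> {d, a} \<in> E \<and> {a, c} \<notin> E \<and> {b, d} \<notin> E)"
        using less.hyps[of W] finW loop by blast
      then have Wr: "realizable W E"
      proof
        assume "\<exists>a b c d. distinct [a, b, c, d] \<and> W = {a, b, c, d} \<and>
          {a, b} \<in> E \<and> {b, c} \<in> E \<and> {c, d} \<in> E \<and> {d, a} \<in> E \<and> {a, c} \<notin> E \<and> {b, d} \<notin> E"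
        then obtain a b c d where C: "distinct [a, b, c, d]" "W = {a, b, c, d}" "{a, c} \<notin> E" by blast
        \<comment> \<open>Opposite vertices of the 4-cycle have degree at most 2 each, so their sum
          does not exceed card W = 4, against \<open>strict\<close>.\<close>
        have "{u \<in> W. {u, a} \<in> E} \<subseteq> {b, d}" "{u \<in> W. {u, c} \<in> E} \<subseteq> {b, d}"
          using C loop[of a] loop[of c] by (auto simp: insert_commute)
        then have "degree W E a \<le> card {b, d}" "degree W E c \<le> card {b, d}"
          unfolding degree_def by (auto intro: card_mono)
        then show ?thesis using strict[of a c] C by simp
      qed
      obtain Y where Y: "Y \<subseteq> H" "card Y = 3" using True by (meson obtain_subset_with_card_n)
      then obtain y1 y2 y3 where y: "Y = {y1, y2, y3}" "y1 \<noteq> y2" "y1 \<noteq> y3" "y2 \<noteq> y3"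
        by (auto simp: card_3_iff)
      have yH: "y1 \<in> H" "y2 \<in> H" "y3 \<in> H" using Y y by auto
      obtain x1 x2 x3 where x: "x1 \<in> W" "{y1, x1} \<in> E" "x2 \<in> W" "{y2, x2} \<in> E" "x3 \<in> W" "{y3, x3} \<in> E"
        using nb[OF yH(1)] nb[OF yH(2)] nb[OF yH(3)] by blast
      then have "x1 \<noteq> x2" "x1 \<noteq> x3" "x2 \<noteq> x3" using uniq yH y by metis+
      then have "realizable (H \<union> W) E"
        using x y yH by (intro realizable_join[OF finH finW disj Hr Wr, of y1 y2 y3 x1 x2 x3])
      then show ?thesis using nV V by simp
    next
      case False
      \<comment> \<open>From here on, maximality of H rules out both triangles and any six vertices
        spanning a \<open>K_{3,3}\<close>.\<close>
      then have small: "card H' \<le> 2" if "H' \<subseteq> V" "realizable H' E" for H'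
        using Hmax[of H'] that unfolding S_def by auto
      have tf: "{a, c} \<notin> E" if "a \<in> V" "b \<in> V" "c \<in> V" "{a, b} \<in> E" "{b, c} \<in> E" for a b c
      proof
        assume ac: "{a, c} \<in> E"
        then have d: "a \<noteq> b" "b \<noteq> c" "a \<noteq> c" using that loop by auto
        then have "realizable {a, b, c} E" using that ac by (intro realizable_triangle) auto
        then show False using small[of "{a, b, c}"] that d by simp
      qed
      obtain x where x: "x \<in> W" using \<open>W \<noteq> {}\<close> by blast
      have "\<exists>y\<in>H. {y, x} \<notin> E"
      proof (rule ccontr)
        assume "\<not> ?thesis"
        then have "{u \<in> H. {u, x} \<in> E} = H" by blast
        then show False using dH1[OF x] h2 unfolding degree_def by simp
      qed
      then obtain y where y: "y \<in> H" "{y, x} \<notin> E" by blast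
      have n4: "card V \<ge> 4" using h2 hw cV by linarith
      have yx: "y \<in> V" "x \<in> V" "y \<noteq> x" using y x HV WV disj by auto
      have "\<exists>N\<subseteq>V. 2 * card N = card V \<and> (\<forall>u\<in>N. \<forall>v\<in>V - N. {u, v} \<in> E)"
        using tf by (rule ore_triangle_free[OF fin ore _ yx y(2) n4])
      then obtain N where N: "N \<subseteq> V" "2 * card N = card V" "\<forall>u\<in>N. \<forall>v\<in>V - N. {u, v} \<in> E"
        by (elim exE conjE)
      have finN: "finite N" using N(1) fin by (rule finite_subset)
      have cVN: "card (V - N) = card N" using N(1,2) finN by (simp add: card_Diff_subset)
      show ?thesis
      proof (cases "card N \<ge> 3")
        case True
        obtain A where A: "A \<subseteq> N" "card A = 3" using True by (meson obtain_subset_with_card_n)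
        obtain B where B: "B \<subseteq> V - N" "card B = 3" using True cVN by (metis obtain_subset_with_card_n)
        obtain a1 a2 a3 where a: "A = {a1, a2, a3}" "a1 \<noteq> a2" "a1 \<noteq> a3" "a2 \<noteq> a3"
          using A(2) by (auto simp: card_3_iff)
        obtain b1 b2 b3 where b: "B = {b1, b2, b3}" "b1 \<noteq> b2" "b1 \<noteq> b3" "b2 \<noteq> b3"
          using B(2) by (auto simp: card_3_iff)
        have "A \<inter> B = {}" using A B by blast
        then have d: "distinct [a1, a2, a3, b1, b2, b3]" using a b by auto
        have "realizable {a1, a2, a3, b1, b2, b3} E"
        proof (rule realizable_K33[OF d])
          fix a b assume "a \<in> {a1, a2, a3}" "b \<in> {b1, b2, b3}"
          then have "a \<in> N" "b \<in> V - N" using A(1) B(1) a(1) b(1) by blast+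
          then show "{a, b} \<in> E" using N(3) by blast
        qed
        moreover have "{a1, a2, a3, b1, b2, b3} \<subseteq> V" using A B N(1) unfolding a(1) b(1) by blast
        ultimately have "card {a1, a2, a3, b1, b2, b3} \<le> 2" by (intro small)
        then show ?thesis using d by simp
      next
        case False
        then have "card N = 2" using N(2) n4 by linarith
        then obtain b d where bd: "N = {b, d}" "b \<noteq> d" by (auto simp: card_2_iff)
        obtain a c where ac: "V - N = {a, c}" "a \<noteq> c"
          using cVN \<open>card N = 2\<close> by (auto simp: card_2_iff)
        have "N \<union> (V - N) = {b, d} \<union> {a, c}" by (subst ac(1), subst bd(1)) (rule refl)
        then have Vabcd: "V = {a, b, c, d}" using N(1) by blast
        have mem: "a \<in> V - N" "c \<in> V - N" "b \<in> N" "d \<in> N" using ac(1) bd(1) by blast+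
        then have dist: "distinct [a, b, c, d]" using ac(2) bd(2) by auto
        have e: "{b, a} \<in> E" "{b, c} \<in> E" "{d, c} \<in> E" "{d, a} \<in> E" using N(3) mem by blast+
        then have e': "{a, b} \<in> E" "{c, d} \<in> E" "{a, d} \<in> E" by (simp_all add: insert_commute)
        \<comment> \<open>Either diagonal would close a triangle with two sides of the
          cycle.\<close>
        have "{a, c} \<notin> E" "{b, d} \<notin> E"
          using tf[of a b c] tf[of b a d] e e' mem N(1) by blast+
        then have "distinct [a, b, c, d] \<and> V = {a, b, c, d} \<and> {a, b} \<in> E \<and> {b, c} \<in> E \<and>
            {c, d} \<in> E \<and> {d, a} \<in> E \<and> {a, c} \<notin> E \<and> {b, d} \<notin> E"
          using dist Vabcd e e' by simp
        then show ?thesis by (intro disjI2 exI)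
      qed
    qed
  qed
qed

theorem theorem5p3:
  fixes V :: "'a set" and E :: "'a set set"
  assumes "simple_graph V E"
    and "\<not> graph_iso V E C4_vertices C4_edges"
    and "\<forall>u\<in>V. \<forall>v\<in>V. u \<noteq> v \<and> {u, v} \<notin> E \<longrightarrow>
           degree V E u + degree V E v \<ge> card V"
  shows "rigid_in_R2 V E"
proof -
  have fin: "finite V" and loop: "{v} \<notin> E" for v
    using assms(1) unfolding simple_graph_def by (auto simp: doubleton_eq_iff)
  have "realizable V E"
  proof (rule ccontr)
    assume "\<not> realizable V E"
    moreover have "ore V E" using assms(3) unfolding ore_def .
    ultimately obtain a b c d where d: "distinct [a, b, c, d]" and V: "V = {a, b, c, d}"
        and e: "{a, b} \<in> E" "{b, c} \<in> E" "{c, d} \<in> E" "{d, a} \<in> E" and ne: "{a, c} \<notin> E" "{b, d} \<notin> E"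
      using ore_realizable[OF fin loop] by blast
    \<comment> \<open>Numbering along the cycle matches sides with \<open>C4_edges\<close> and
      diagonals with non-edges.\<close>
    define f where "f = (\<lambda>v. if v = a then 0 else if v = b then 1 else if v = c then 2 else 3 :: nat)"
    have f: "f a = 0" "f b = 1" "f c = 2" "f d = 3" using d unfolding f_def by auto
    have "bij_betw f V C4_vertices"
      unfolding bij_betw_def V C4_vertices_def using d by (auto simp: f)
    moreover have "{u, v} \<in> E \<longleftrightarrow> {f u, f v} \<in> C4_edges" if "u \<in> V" "v \<in> V" for u v
    proof -
      have "{b, a} \<in> E" "{c, b} \<in> E" "{d, c} \<in> E" "{a, d} \<in> E" "{c, a} \<notin> E" "{d, b} \<notin> E"
        using e ne by (simp_all add: insert_commute)
      then show ?thesis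
        using that e ne loop unfolding V C4_edges_def
        by (elim insertE emptyE) (simp_all add: f doubleton_eq_iff)
    qed
    ultimately show False using assms(2) unfolding graph_iso_def by blast
  qed
  then show ?thesis by (rule rigid_in_R2_of_realizable[OF fin])
qed

end
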